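(* For complex $z$ with $|z|\le 1$ (where for $z=1$ the right-hand side is understood as its limit as $z\to1$), $$g(z) := \int_0^1\int_0^1 \frac{dx\,dy}{(1-xyz)(1+x)(1+y)} = \frac{1}{1-z}\left\{\operatorname{Li}_2(z) + \log^2 2 - 2\left[\operatorname{Li}_2\left(\tfrac{1+z}{2}\right) - \operatorname{Li}_2\left(\tfrac{1}{2}\right)\right]\right\},$$ with $g(1)=\log 2$ and $g(-1)=\frac{\pi^2}{24}$. Further, for complex $z$ with $|z|\le 1$ (where for $z=\pm1$ the right-hand side is understood as its limit as $z\to\pm1$), $$\begin{aligned} G(z) := -\int_0^1\int_0^1 \frac{\log(1-xyz)\,dx\,dy}{xy(1+x)(1+y)} ={}& \int_0^z \frac{\operatorname{Li}_2(t)}{1-t}\,dt + \log(1-z)\left[2\operatorname{Li}_2\left(\tfrac{1+z}{2}\right) - \tfrac{\pi^2}{6}\right] \\ &+ 2\log(1+z)\left(\log^2(1-z) - \log^2 2\right) + 2\log 2\left[\operatorname{Li}_2\left(\tfrac{1+z}{2}\right) - \operatorname{Li}_2\left(\tfrac{1}{2}\right)\right] \\ &- 2\log 2\,\log^2(1-z) + 4\log(1-z)\operatorname{Li}_2\left(\tfrac{1-z}{2}\right) - 4\left[\operatorname{Li}_3\left(\tfrac{1-z}{2}\right) - \operatorname{Li}_3\left(\tfrac{1}{2}\right)\right],\end{aligned}$$ with $$G(1)=\frac32\zeta(3)-\frac{\pi^2}{6}\log 2-\frac13\log^3 2,\qquad G(-1)=\frac{\pi^2}{12}\log 2-\frac34\zeta(3)-\frac13\log^3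 2.$$
   Context: $\operatorname{Li}_m(t)=\sum_{n=1}^\infty \frac{t^n}{n^m}$ for $|t|\le 1$, $m=2,3$. $\log$ is the principal branch of the natural logarithm, $\log^k a=(\log a)^k$, $\zeta$ is the Riemann zeta function, and $\int_0^z$ is taken along the straight segment from $0$ to $z$. *)

theory Defs
  imports "HOL-Complex_Analysis.Complex_Analysis"
begin

(* Only meaningful for norm t \<le> 1 and m \<ge> 2, where the series converges. *)
definition polylog :: "nat \<Rightarrow> complex \<Rightarrow> complex" where
  "polylog m t = (\<Sum>n. t ^ Suc n / of_nat (Suc n) ^ m)"

(* The Dirichlet series; equal to the Riemann zeta function only for Re s > 1. *)
definition zeta :: "complex \<Rightarrow> complex" where
  "zeta s = (\<Sum>n. 1 / of_nat (Suc n) powr s)"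

abbreviation unit_square :: "(real \<times> real) set" where
  "unit_square \<equiv> {0..1} \<times> {0..1}"

(* In both integrands a division by zero can only occur on a null set
   (the axes, and the corner (1, 1) when z = 1). *)
definition g_integrand :: "complex \<Rightarrow> real \<times> real \<Rightarrow> complex" where
  "g_integrand z = (\<lambda>(x, y).
     1 / ((1 - of_real x * of_real y * z) * (1 + of_real x) * (1 + of_real y)))"

definition G_integrand :: "complex \<Rightarrow> real \<times> real \<Rightarrow> complex" where
  "G_integrand z = (\<lambda>(x, y).
     ln (1 - of_real x * of_real y * z) /
       (of_real x * of_real y * (1 + of_real x) * (1 + of_real y)))"

definition g :: "complex \<Rightarrow> complex" where
  "g z = (LINT p:unit_square|lborel. g_integrand z p)"

definition G :: "complex \<Rightarrow> complex" where
  "G z = - (LINT p:unit_square|lborel. G_integrand z p)"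

definition g_closed :: "complex \<Rightarrow> complex" where
  "g_closed z = 1 / (1 - z) *
     (polylog 2 z + (ln 2)\<^sup>2 - 2 * (polylog 2 ((1 + z) / 2) - polylog 2 (1 / 2)))"

definition G_closed :: "complex \<Rightarrow> complex" where
  "G_closed z =
     contour_integral (linepath 0 z) (\<lambda>t. polylog 2 t / (1 - t))
     + ln (1 - z) * (2 * polylog 2 ((1 + z) / 2) - of_real pi ^ 2 / 6)
     + 2 * ln (1 + z) * ((ln (1 - z))\<^sup>2 - (ln 2)\<^sup>2)
     + 2 * ln 2 * (polylog 2 ((1 + z) / 2) - polylog 2 (1 / 2))
     - 2 * ln 2 * (ln (1 - z))\<^sup>2
     + 4 * ln (1 - z) * polylog 2 ((1 - z) / 2)
     - 4 * (polylog 3 ((1 - z) / 2) - polylog 3 (1 / 2))"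

end

theory Submission
  imports Defs "HOL-Real_Asymp.Real_Asymp"
begin

text \<open>
  Let \<open>a\<^sub>n\<close> be the integral of \<open>x\<^sup>n / (1 + x)\<close> over \<open>[0, 1]\<close> (\<open>moment n\<close> below). Expanding
  \<open>1 / (1 - xyz)\<close> and \<open>log (1 - xyz)\<close> in powers of \<open>xyz\<close> and integrating termwise turns the two double
  integrals into the power series with coefficients \<open>a\<^sub>n\<^sup>2\<close> (for \<open>g\<close>) and \<open>a\<^sub>n\<^sub>-\<^sub>1\<^sup>2 / n\<close> (for \<open>G\<close>).
  As \<open>0 \<le> a\<^sub>n \<le> 1 / (n + 1)\<close>, these coefficients are absolutely summable, so both functions are
  continuous on the closed unit disk. This is why the identities on the unit circle and the limits
  of the closed forms reduce to identities in the interior.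

  Everything about \<open>g\<close> follows from the recursion \<open>a\<^sub>n + a\<^sub>n\<^sub>+\<^sub>1 = 1 / (n + 1)\<close>. It says that
  \<open>a\<^sub>n\<^sup>2 - a\<^sub>n\<^sub>-\<^sub>1\<^sup>2 = 1 / n\<^sup>2 - 2 a\<^sub>n\<^sub>-\<^sub>1 / n\<close>, which is the coefficient form of
  \<open>(1 - z) g(z) = Li\<^sub>2(z) + log\<^sup>2 2 - 2 Q(z)\<close> with \<open>Q(z) = \<Sum> a\<^sub>n\<^sub>-\<^sub>1 z\<^sup>n / n\<close>
  (lemma \<open>g_functional_equation\<close>; \<open>Q\<close> is \<open>moment_series\<close>). The recursion also gives \<open>Q'(z) = (log 2 - log (1 - z)) / (1 + z)\<close>,
  whence \<open>Q(z) = Li\<^sub>2((1 + z)/2) - Li\<^sub>2(1/2)\<close>. Moreover it telescopes \<open>\<Sum> a\<^sub>n\<^sup>2\<close> to \<open>log 2\<close>, and the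
  functional equation at \<open>z = 1\<close>, where its left-hand side vanishes, evaluates \<open>Li\<^sub>2(1/2)\<close>.

  Inside the disk \<open>G' = g\<close>. The derivative of the explicit part of the closed form of \<open>G\<close> is
  \<open>g(z) - Li\<^sub>2(z) / (1 - z)\<close> (lemma \<open>G_explicit_deriv\<close>), so the fundamental theorem of calculus along the
  segment from \<open>0\<close> to \<open>z\<close> produces the remaining integral. At the end point of the segment only
  continuity matters, hence \<open>z\<close> may lie on the unit circle.

  The values \<open>G(1)\<close> and \<open>G(-1)\<close> need more, since single terms of the closed form diverge there.
  Integrating the remaining integral by parts leaves a primitive of \<open>- log\<^sup>2(1 - z) / z\<close>. On \<open>(0, 1)\<close> and
  on \<open>(-1, 0)\<close> such a primitive is also known explicitly, in terms of \<open>Li\<^sub>2\<close> and \<open>Li\<^sub>3\<close> at \<open>1 - x\<close> and at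
  \<open>1 / (1 + x)\<close>. The two primitives differ by a constant on each interval; comparing the limits at both
  ends gives \<open>G(\<plusminus>1)\<close> in terms of \<open>Li\<^sub>2(1/2)\<close> and \<open>Li\<^sub>3(1/2)\<close>. The latter value comes from Landen's identity
  for the trilogarithm.
\<close>

section \<open>The moments of \<open>1 / (1 + x)\<close>\<close>

definition moment :: "nat \<Rightarrow> real" where
  "moment n = integral {0..1} (\<lambda>x. x ^ n / (1 + x))"

lemma moment_integrand_continuous: "continuous_on {0..1} (\<lambda>x::real. x ^ n / (1 + x))"
  by (intro continuous_intros) auto

lemma moment_has_integral: "((\<lambda>x. x ^ n / (1 + x)) has_integral moment n) {0..1}"
  unfolding moment_def
  by (intro integrable_integral integrable_continuous_interval moment_integrand_continuous)

lemma power_has_integral: "((\<lambda>x::real. x ^ n) has_integral (1 / (real n + 1))) {0..1}"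
proof -
  have "((\<lambda>x::real. x ^ n) has_integral (1 ^ Suc n / real (Suc n) - 0 ^ Suc n / real (Suc n))) {0..1}"
  proof (rule fundamental_theorem_of_calculus)
    fix x :: real
    have "((\<lambda>x. x ^ Suc n / real (Suc n)) has_real_derivative (real (Suc n) * x ^ n / real (Suc n)))
            (at x within {0..1})"
      by (intro derivative_eq_intros) (auto simp del: of_nat_Suc)
    thus "((\<lambda>x. x ^ Suc n / real (Suc n)) has_vector_derivative x ^ n) (at x within {0..1})"
      by (simp add: has_real_derivative_iff_has_vector_derivative del: of_nat_Suc)
  qed simp
  thus ?thesis by (simp add: add.commute)
qed

lemma moment_0: "moment 0 = ln 2"
proof -
  have "((\<lambda>x::real. x ^ 0 / (1 + x)) has_integral (ln (1 + 1) - ln (1 + 0))) {0..1}"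
    by (rule fundamental_theorem_of_calculus)
       (auto intro!: derivative_eq_intros simp flip: has_real_derivative_iff_has_vector_derivative
             simp: divide_simps)
  from has_integral_unique[OF moment_has_integral this] show ?thesis by simp
qed

lemma moment_add_Suc: "moment n + moment (Suc n) = 1 / (real n + 1)"
proof -
  have "((\<lambda>x. x ^ n / (1 + x) + x ^ Suc n / (1 + x)) has_integral (moment n + moment (Suc n))) {0..1}"
    by (intro has_integral_add moment_has_integral)
  also have "?this \<longleftrightarrow> ((\<lambda>x::real. x ^ n) has_integral (moment n + moment (Suc n))) {0..1}"
  proof (rule has_integral_cong)
    fix x :: real assume "x \<in> {0..1}"
    hence "x ^ n / (1 + x) + x ^ Suc n / (1 + x) = x ^ n * (1 + x) / (1 + x)" "1 + x \<noteq> 0"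
      by (auto simp: algebra_simps add_divide_distrib)
    thus "x ^ n / (1 + x) + x ^ Suc n / (1 + x) = x ^ n" by simp
  qed
  finally show ?thesis
    using power_has_integral has_integral_unique by blast
qed

lemma moment_nonneg: "moment n \<ge> 0"
  unfolding moment_def by (rule integral_nonneg)
    (auto intro!: integrable_continuous_interval moment_integrand_continuous)

lemma moment_le: "moment n \<le> 1 / (real n + 1)"
  using moment_add_Suc[of n] moment_nonneg[of "Suc n"] by linarith

lemma moment_sq_le: "(moment n)\<^sup>2 \<le> 1 / (real n + 1)\<^sup>2"
  using power_mono[OF moment_le moment_nonneg, of n 2] by (simp add: power_divide)

lemma summable_inverse_Suc_squares: "summable (\<lambda>n. 1 / (real n + 1)\<^sup>2)"
  using sums_summable[OF inverse_squares_sums] by (simp add: add.commute)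

lemma summable_moment_sq: "summable (\<lambda>n. (moment n)\<^sup>2)"
  by (rule summable_comparison_test'[OF summable_inverse_Suc_squares, of 0])
     (use moment_sq_le in auto)

lemma moment_sq_sums: "(\<lambda>n. (moment n)\<^sup>2) sums ln 2"
proof -
  \<comment> \<open>The recursion gives \<open>n (a\<^sub>n\<^sup>2 - a\<^sub>n\<^sub>-\<^sub>1\<^sup>2) = a\<^sub>n - a\<^sub>n\<^sub>-\<^sub>1\<close>; summation by parts then yields this closed form.\<close>
  have partial: "(\<Sum>n<N. (moment n)\<^sup>2) = real N * (moment N)\<^sup>2 + ln 2 - moment N" for N
  proof (induction N)
    case (Suc N)
    have "(real N + 1) * (moment N)\<^sup>2 - (real N + 1) * (moment (Suc N))\<^sup>2
         = (real N + 1) * (moment N + moment (Suc N)) * (moment N - moment (Suc N))"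
      by (simp add: power2_eq_square algebra_simps)
    also have "\<dots> = moment N - moment (Suc N)"
      unfolding moment_add_Suc by simp
    finally have "(real N + 1) * (moment N)\<^sup>2 - moment N
         = (real N + 1) * (moment (Suc N))\<^sup>2 - moment (Suc N)" by simp
    with Suc show ?case by (simp add: algebra_simps)
  qed (simp add: moment_0)
  have inv: "(\<lambda>N. 1 / (real N + 1)) \<longlonglongrightarrow> 0"
    using LIMSEQ_inverse_real_of_nat by (simp add: inverse_eq_divide add.commute)
  have m: "moment \<longlonglongrightarrow> 0"
    by (rule tendsto_sandwich[OF _ _ tendsto_const inv])
       (simp_all add: moment_nonneg moment_le)
  have "real N * (moment N)\<^sup>2 \<le> 1 / (real N + 1)" for N
  proof -
    have "real N * (moment N)\<^sup>2 \<le> (real N + 1) * (1 / (real N + 1)\<^sup>2)"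
      by (intro mult_mono moment_sq_le) auto
    thus ?thesis by (simp add: power2_eq_square)
  qed
  hence "(\<lambda>N. real N * (moment N)\<^sup>2) \<longlonglongrightarrow> 0"
    by (intro tendsto_sandwich[OF _ _ tendsto_const inv]) auto
  from tendsto_diff[OF tendsto_add[OF this tendsto_const[of "ln 2"]] m]
  show ?thesis unfolding sums_def partial by simp
qed

section \<open>Termwise integration over the unit square\<close>

lemma moment_lborel:
  defines "k \<equiv> \<lambda>n x. indicator {0..1} x * (x ^ n / (1 + x)) :: real"
  shows "integrable lborel (k n)" "(\<integral>x. k n x \<partial>lborel) = moment n"
  using borel_integrable_atLeastAtMost'[OF moment_integrand_continuous, of n]
        set_borel_integral_eq_integral(2)[of "{0..1}" "\<lambda>x::real. x ^ n / (1 + x)"]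
  unfolding k_def moment_def set_integrable_def set_lebesgue_integral_def by auto

definition square_monomial :: "nat \<Rightarrow> real \<times> real \<Rightarrow> real" where
  "square_monomial n = (\<lambda>(x, y). (x * y) ^ n / ((1 + x) * (1 + y)))"

lemma square_monomial_lborel:
  "set_integrable lborel unit_square (square_monomial n)"
  "(LINT p:unit_square|lborel. square_monomial n p) = (moment n)\<^sup>2"
proof -
  define k where "k = (\<lambda>x. indicator {0..1} x * (x ^ n / (1 + x)) :: real)"
  have k: "integrable lborel k" "(\<integral>x. k x \<partial>lborel) = moment n"
    using moment_lborel[of n] by (auto simp: k_def)
  have [measurable]: "k \<in> borel_measurable borel"
    using k(1) by auto
  have k_nn: "norm (k x) = k x" for x
    by (auto simp: k_def indicator_def)
  have eq: "indicator unit_square p *\<^sub>R square_monomial n p = k (fst p) * k (snd p)" for p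
    by (cases p) (auto simp: k_def indicator_def square_monomial_def power_mult_distrib)
  have int: "integrable (lborel \<Otimes>\<^sub>M lborel) (\<lambda>p. k (fst p) * k (snd p))"
  proof (rule lborel_pair.Fubini_integrable)
    show "integrable lborel (\<lambda>x. \<integral>y. norm (k (fst (x, y)) * k (snd (x, y))) \<partial>lborel)"
      by (simp add: norm_mult k_nn k del: real_norm_def)
    show "AE x in lborel. integrable lborel (\<lambda>y. k (fst (x, y)) * k (snd (x, y)))"
      using k by simp
  qed simp
  show "set_integrable lborel unit_square (square_monomial n)"
    using int unfolding set_integrable_def eq by (simp add: lborel_prod)
  have "(\<integral>p. k (fst p) * k (snd p) \<partial>(lborel \<Otimes>\<^sub>M lborel)) = (moment n)\<^sup>2"
    by (subst lborel_pair.integral_fst'[OF int, symmetric]) (simp add: k power2_eq_square)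
  thus "(LINT p:unit_square|lborel. square_monomial n p) = (moment n)\<^sup>2"
    unfolding set_lebesgue_integral_def eq by (simp add: lborel_prod)
qed

lemma AE_lborel_pair_off_edges:
  "AE p in lborel. fst p \<noteq> (a::real) \<and> snd p \<noteq> (b::real)"
proof -
  have "AE p in lborel \<Otimes>\<^sub>M lborel. fst p \<noteq> a \<and> snd p \<noteq> b"
  proof (rule lborel_pair.AE_pair_measure)
    show "AE x in lborel. AE y in lborel. fst (x, y) \<noteq> a \<and> snd (x, y) \<noteq> b"
      using AE_lborel_singleton[of a] by eventually_elim (use AE_lborel_singleton[of b] in auto)
  qed measurable
  thus ?thesis by (simp only: lborel_prod)
qed

text \<open>
  Dominated convergence for series. The edges of the square form a null set, which disposes of the
  points where the series diverges or the integrand has a vanishing denominator; summability of the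
  integrals is that of the squared moments.
\<close>

lemma square_integral_power_series:
  fixes c :: "nat \<Rightarrow> complex" and f :: "real \<times> real \<Rightarrow> complex"
  assumes c: "\<And>n. norm (c n) \<le> 1"
    and meas: "f \<in> borel_measurable borel"
    and f: "\<And>x y. 0 < x \<Longrightarrow> x < 1 \<Longrightarrow> 0 < y \<Longrightarrow> y < 1 \<Longrightarrow>
              (\<lambda>n. c n * of_real (square_monomial n (x, y))) sums f (x, y)"
  shows "set_integrable lborel unit_square f"
    and "(\<lambda>n. c n * of_real ((moment n)\<^sup>2)) sums (LINT p:unit_square|lborel. f p)"
proof -
  define h where "h = (\<lambda>n p. c n * of_real (indicator unit_square p *\<^sub>R square_monomial n p))"
  have int: "integrable lborel (h n)" for n
    using square_monomial_lborel(1)[of n] unfolding h_def set_integrable_def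
    by (intro integrable_mult_right integrable_of_real)
  have nn: "0 \<le> indicator unit_square p *\<^sub>R square_monomial n p" for n p
    by (auto simp: indicator_def square_monomial_def)
  have normh: "norm (h n p) = norm (c n) * (indicator unit_square p *\<^sub>R square_monomial n p)" for n p
    unfolding h_def norm_mult norm_of_real abs_of_nonneg[OF nn] ..
  have inth: "(\<integral>p. norm (h n p) \<partial>lborel) = norm (c n) * (moment n)\<^sup>2" for n
    unfolding normh using square_monomial_lborel[of n]
    by (simp add: set_lebesgue_integral_def)
  have summ: "summable (\<lambda>n. \<integral>p. norm (h n p) \<partial>lborel)"
    unfolding inth
    by (rule summable_comparison_test'[OF summable_moment_sq, of 0])
       (auto simp: norm_mult intro!: mult_left_le_one_le c)
  have edges: "AE p in lborel. fst p \<noteq> (0::real) \<and> snd p \<noteq> 0 \<and> fst p \<noteq> 1 \<and> snd p \<noteq> (1::real)"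
    using AE_lborel_pair_off_edges[of 0 0] AE_lborel_pair_off_edges[of 1 1] by auto
  have AEs: "AE p in lborel. summable (\<lambda>n. norm (h n p))"
    using edges
  proof eventually_elim
    case (elim p)
    obtain x y where p: "p = (x, y)" by force
    show ?case
    proof (cases "p \<in> unit_square")
      case True
      hence xy: "0 < x" "x < 1" "0 < y" "y < 1" using elim by (auto simp: p)
      hence "x * y < 1" by (metis mult_strict_mono' less_eq_real_def mult_1)
      hence geo: "summable (\<lambda>n. (x * y) ^ n / ((1 + x) * (1 + y)))"
        using xy by (intro summable_divide summable_geometric) auto
      have "norm (h n p) \<le> (x * y) ^ n / ((1 + x) * (1 + y))" for n
        using xy c[of n] unfolding normh
        by (auto simp: p square_monomial_def indicator_def intro!: divide_right_mono mult_left_le_one_le)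
      thus ?thesis
        by (intro summable_comparison_test'[OF geo, of 0]) auto
    qed (simp add: h_def)
  qed
  have AEf: "AE p in lborel. (\<Sum>n. h n p) = indicator unit_square p *\<^sub>R f p"
    using edges
  proof eventually_elim
    case (elim p)
    obtain x y where p: "p = (x, y)" by force
    show ?case
    proof (cases "p \<in> unit_square")
      case True
      hence "0 < x" "x < 1" "0 < y" "y < 1" using elim by (auto simp: p)
      from sums_unique[OF f[OF this]] True show ?thesis
        by (simp add: h_def p)
    qed (simp add: h_def)
  qed
  have sq: "unit_square \<in> sets borel"
    by (intro borel_closed closed_Times) auto
  have [measurable]: "(\<lambda>p. indicator unit_square p *\<^sub>R f p) \<in> borel_measurable lborel"
    using meas sq by measurable
  have [measurable]: "(\<lambda>p. \<Sum>n. h n p) \<in> borel_measurable lborel"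
    using integrable_suminf[OF int AEs summ] by auto
  show "set_integrable lborel unit_square f"
    unfolding set_integrable_def
    using integrable_cong_AE_imp[OF integrable_suminf[OF int AEs summ] _ AEf] by simp
  have "(\<integral>p. h n p \<partial>lborel) = c n * of_real ((moment n)\<^sup>2)" for n
    using square_monomial_lborel(2)[of n] unfolding h_def set_lebesgue_integral_def
    by (simp only: integral_mult_right_zero integral_complex_of_real)
  moreover have "(\<integral>p. (\<Sum>n. h n p) \<partial>lborel) = (LINT p:unit_square|lborel. f p)"
    unfolding set_lebesgue_integral_def by (rule integral_cong_AE) (use AEf in auto)
  ultimately show "(\<lambda>n. c n * of_real ((moment n)\<^sup>2)) sums (LINT p:unit_square|lborel. f p)"
    using sums_integral[OF int AEs summ] by simp
qed

lemma g_integrand_measurable: "g_integrand z \<in> borel_measurable borel"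
proof -
  have "g_integrand z \<in> borel_measurable (borel \<Otimes>\<^sub>M borel)"
    unfolding g_integrand_def by measurable
  thus ?thesis by (simp add: borel_prod)
qed

lemma G_integrand_measurable: "G_integrand z \<in> borel_measurable borel"
proof -
  have "G_integrand z \<in> borel_measurable (borel \<Otimes>\<^sub>M borel)"
    unfolding G_integrand_def by measurable
  thus ?thesis by (simp add: borel_prod)
qed

lemma norm_mult_less_1:
  assumes "norm (z::complex) \<le> 1" "0 < x" "x < 1" "0 < y" "y < 1"
  shows "norm (of_real x * of_real y * z) < 1"
proof -
  have "x * y * norm z \<le> x * y"
    using assms by (intro mult_right_le_one_le) auto
  also have "x * y < 1"
    using mult_strict_mono'[of x 1 y 1] assms by simp
  finally show ?thesis using assms by (simp add: norm_mult)
qed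

lemma complex_ln_2: "ln (2::complex) = of_real (ln 2)"
  using Ln_of_real[of 2] by simp

lemma minus_Ln_sums:
  assumes "norm (w::complex) < 1"
  shows "(\<lambda>n. w ^ n / of_nat n) sums (- ln (1 - w))"
  using sums_minus[OF Ln_series'[of "-w"]] assms by simp

lemma g_power_series:
  assumes "norm z \<le> 1"
  shows "set_integrable lborel unit_square (g_integrand z)"
    and "(\<lambda>n. of_real ((moment n)\<^sup>2) * z ^ n) sums g z"
proof -
  have s: "(\<lambda>n. z ^ n * of_real (square_monomial n (x, y))) sums g_integrand z (x, y)"
    if xy: "0 < x" "x < 1" "0 < y" "y < 1" for x y
  proof -
    have "(\<lambda>n. (of_real x * of_real y * z) ^ n / ((1 + of_real x) * (1 + of_real y)))
            sums (1 / (1 - of_real x * of_real y * z) / ((1 + of_real x) * (1 + of_real y)))"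
      by (intro sums_divide geometric_sums norm_mult_less_1 assms xy)
    thus ?thesis
      by (simp add: square_monomial_def g_integrand_def power_mult_distrib mult_ac)
  qed
  have c: "norm (z ^ n) \<le> 1" for n
    using assms by (simp add: norm_power power_le_one)
  show "set_integrable lborel unit_square (g_integrand z)"
    by (rule square_integral_power_series(1)[OF c g_integrand_measurable s])
  show "(\<lambda>n. of_real ((moment n)\<^sup>2) * z ^ n) sums g z"
    using square_integral_power_series(2)[OF c g_integrand_measurable s]
    by (simp add: g_def mult.commute)
qed

lemma G_power_series:
  assumes "norm z \<le> 1"
  shows "set_integrable lborel unit_square (G_integrand z)"
    and "(\<lambda>n. of_real ((moment n)\<^sup>2 / real (Suc n)) * z ^ Suc n) sums G z"
proof -
  define c where "c = (\<lambda>n. - (z ^ Suc n / of_nat (Suc n)))"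
  have s: "(\<lambda>n. c n * of_real (square_monomial n (x, y))) sums G_integrand z (x, y)"
    if xy: "0 < x" "x < 1" "0 < y" "y < 1" for x y
  proof -
    define w where "w = of_real x * of_real y * z"
    have "(\<lambda>n. w ^ Suc n / of_nat (Suc n)) sums (- ln (1 - w))"
      using minus_Ln_sums[OF norm_mult_less_1[OF assms xy]]
      by (subst sums_Suc_iff) (simp add: w_def)
    from sums_divide[OF sums_minus[OF this],
        of "of_real x * of_real y * (1 + of_real x) * (1 + of_real y)"]
    have "(\<lambda>n. - (w ^ Suc n / of_nat (Suc n)) /
               (of_real x * of_real y * (1 + of_real x) * (1 + of_real y))) sums G_integrand z (x, y)"
      by (simp add: G_integrand_def w_def)
    moreover have "- (w ^ Suc n / of_nat (Suc n)) /
               (of_real x * of_real y * (1 + of_real x) * (1 + of_real y))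
             = c n * of_real (square_monomial n (x, y))" for n
      using xy by (simp add: c_def w_def square_monomial_def power_mult_distrib del: of_nat_Suc)
    ultimately show ?thesis by simp
  qed
  have c: "norm (c n) \<le> 1" for n
  proof -
    have "norm (z ^ Suc n) \<le> 1"
      using assms unfolding norm_power by (intro power_le_one) auto
    also have "1 \<le> real (Suc n)" by simp
    finally show ?thesis
      by (simp add: c_def norm_divide divide_le_eq del: of_nat_Suc)
  qed
  show "set_integrable lborel unit_square (G_integrand z)"
    by (rule square_integral_power_series(1)[OF c G_integrand_measurable s])
  show "(\<lambda>n. of_real ((moment n)\<^sup>2 / real (Suc n)) * z ^ Suc n) sums G z"
    using sums_minus[OF square_integral_power_series(2)[OF c G_integrand_measurable s]]
    by (simp add: G_def c_def mult.commute del: of_nat_Suc)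
qed

section \<open>Power series with absolutely summable coefficients\<close>

definition powser :: "(nat \<Rightarrow> complex) \<Rightarrow> complex \<Rightarrow> complex" where
  "powser c z = (\<Sum>n. c n * z ^ n)"

lemma powser_summable:
  fixes c :: "nat \<Rightarrow> complex"
  assumes "summable (\<lambda>n. norm (c n))" "norm z \<le> 1"
  shows "summable (\<lambda>n. c n * z ^ n)"
proof (rule summable_comparison_test'[OF assms(1), of 0])
  show "norm (c n * z ^ n) \<le> norm (c n)" for n
    using assms(2) by (auto simp: norm_mult norm_power intro!: mult_right_le_one_le power_le_one)
qed

lemma powser_sums:
  fixes c :: "nat \<Rightarrow> complex"
  assumes "summable (\<lambda>n. norm (c n))" "norm z \<le> 1"
  shows "(\<lambda>n. c n * z ^ n) sums powser c z"
  unfolding powser_def by (intro summable_sums powser_summable assms)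

lemma powser_0: "powser c 0 = c 0"
  unfolding powser_def by (rule powser_zero)

lemma powser_continuous:
  fixes c :: "nat \<Rightarrow> complex"
  assumes "summable (\<lambda>n. norm (c n))"
  shows "continuous_on (cball 0 1) (powser c)"
proof (rule uniform_limit_theorem)
  show "uniform_limit (cball 0 1) (\<lambda>n z. \<Sum>i<n. c i * z ^ i) (powser c) sequentially"
    unfolding powser_def
  proof (rule Weierstrass_m_test[OF _ assms])
    show "norm (c n * z ^ n) \<le> norm (c n)" if "z \<in> cball 0 1" for n z
      using that by (auto simp: norm_mult norm_power intro!: mult_right_le_one_le power_le_one)
  qed
qed (auto intro!: continuous_intros always_eventually)

lemma powser_deriv:
  fixes c :: "nat \<Rightarrow> complex"
  assumes "summable (\<lambda>n. norm (c n))" "norm z < 1"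
  shows "(powser c has_field_derivative powser (diffs c) z) (at z)"
    and "summable (\<lambda>n. diffs c n * z ^ n)"
proof -
  have s: "summable (\<lambda>n. c n * 1 ^ n)"
    using powser_summable[OF assms(1), of 1] by simp
  show "(powser c has_field_derivative powser (diffs c) z) (at z)"
    unfolding powser_def[abs_def] using termdiffs_strong[OF s] assms(2) by simp
  have "summable (\<lambda>n. c n * x ^ n)" if "norm x < 1" for x
    using that by (intro powser_summable assms(1)) auto
  thus "summable (\<lambda>n. diffs c n * z ^ n)"
    using assms(2) by (rule termdiff_converges[rotated])
qed

text \<open>
  Multiplying the derivative by \<open>z\<close> restores the exponents, so that coefficients can be compared
  without an index shift.
\<close>

lemma powser_deriv_times:
  fixes c :: "nat \<Rightarrow> complex"
  assumes "summable (\<lambda>n. norm (c n))" "norm z < 1"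
  shows "(\<lambda>n. of_nat n * c n * z ^ n) sums (z * powser (diffs c) z)"
proof -
  have "(\<lambda>n. z * (of_nat n * c n * z ^ (n - Suc 0))) sums (z * powser (diffs c) z)"
    unfolding powser_def by (intro sums_mult diffs_equiv powser_deriv(2) assms)
  also have "(\<lambda>n. z * (of_nat n * c n * z ^ (n - Suc 0))) = (\<lambda>n. of_nat n * c n * z ^ n)"
  proof
    fix n show "z * (of_nat n * c n * z ^ (n - Suc 0)) = of_nat n * c n * z ^ n"
      by (cases n) auto
  qed
  finally show ?thesis .
qed

section \<open>Polylogarithms\<close>

text \<open>
  The coefficient at \<open>0\<close> is \<open>1 / 0 = 0\<close> for \<open>m > 0\<close>, so the series that starts at exponent \<open>1\<close> can be
  written as a power series from exponent \<open>0\<close>.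
\<close>

definition polylog_coeff :: "nat \<Rightarrow> nat \<Rightarrow> complex" where
  "polylog_coeff m n = 1 / of_nat n ^ m"

lemma polylog_coeff_summable:
  assumes "m \<ge> 2"
  shows "summable (\<lambda>n. norm (polylog_coeff m n))"
  using inverse_power_summable[OF assms, where 'a = real]
  by (simp add: polylog_coeff_def norm_inverse norm_power divide_inverse)

lemma polylog_eq_powser:
  assumes "m \<ge> 2" "norm z \<le> 1"
  shows "polylog m z = powser (polylog_coeff m) z"
proof -
  have "(\<lambda>n. polylog_coeff m (Suc n) * z ^ Suc n) sums powser (polylog_coeff m) z"
  proof (subst sums_Suc_iff)
    have "polylog_coeff m 0 = 0"
      using assms(1) by (simp add: polylog_coeff_def)
    thus "(\<lambda>n. polylog_coeff m n * z ^ n) sums (powser (polylog_coeff m) z + polylog_coeff m 0 * z ^ 0)"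
      using powser_sums[OF polylog_coeff_summable[OF assms(1)] assms(2)] by simp
  qed
  thus ?thesis
    by (simp add: polylog_def polylog_coeff_def sums_iff del: of_nat_Suc)
qed

lemma polylog_sums:
  assumes "m \<ge> 2" "norm z \<le> 1"
  shows "(\<lambda>n. polylog_coeff m n * z ^ n) sums polylog m z"
  using powser_sums[OF polylog_coeff_summable] polylog_eq_powser assms by simp

lemma polylog_continuous:
  assumes "m \<ge> 2"
  shows "continuous_on (cball 0 1) (polylog m)"
  using powser_continuous[OF polylog_coeff_summable[OF assms]]
  by (subst continuous_on_cong[OF refl polylog_eq_powser[OF assms]]) auto

lemma polylog_0 [simp]: "polylog m 0 = 0"
  by (simp add: polylog_def)

lemma polylog_deriv_powser:
  assumes "m \<ge> 2" "norm z < 1"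
  shows "(polylog m has_field_derivative powser (diffs (polylog_coeff m)) z) (at z)"
  by (rule has_field_derivative_transform_within_open[OF
        powser_deriv(1)[OF polylog_coeff_summable], of _ _ "ball 0 1"])
     (use assms in \<open>auto simp: polylog_eq_powser\<close>)

lemma polylog2_deriv:
  assumes "norm z < 1" "z \<noteq> 0"
  shows "(polylog 2 has_field_derivative (- ln (1 - z) / z)) (at z)"
proof -
  have "(\<lambda>n. of_nat n * polylog_coeff 2 n * z ^ n) sums (z * powser (diffs (polylog_coeff 2)) z)"
    by (rule powser_deriv_times[OF polylog_coeff_summable]) (use assms in auto)
  moreover have "(\<lambda>n. of_nat n * polylog_coeff 2 n * z ^ n) = (\<lambda>n. z ^ n / of_nat n)"
    by (auto simp: polylog_coeff_def power2_eq_square)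
  ultimately have "z * powser (diffs (polylog_coeff 2)) z = - ln (1 - z)"
    using minus_Ln_sums[OF assms(1)] sums_unique2 by metis
  hence "powser (diffs (polylog_coeff 2)) z = - ln (1 - z) / z"
    using assms(2) by (simp add: field_simps)
  thus ?thesis
    using polylog_deriv_powser[of 2 z] assms by simp
qed

lemma polylog_Suc_deriv:
  assumes "m \<ge> 2" "norm z < 1" "z \<noteq> 0"
  shows "(polylog (Suc m) has_field_derivative (polylog m z / z)) (at z)"
proof -
  have "(\<lambda>n. of_nat n * polylog_coeff (Suc m) n * z ^ n)
          sums (z * powser (diffs (polylog_coeff (Suc m))) z)"
    by (rule powser_deriv_times[OF polylog_coeff_summable]) (use assms in auto)
  moreover have "(\<lambda>n. of_nat n * polylog_coeff (Suc m) n * z ^ n) = (\<lambda>n. polylog_coeff m n * z ^ n)"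
  proof
    fix n show "of_nat n * polylog_coeff (Suc m) n * z ^ n = polylog_coeff m n * z ^ n"
      using assms(1) by (cases n) (auto simp: polylog_coeff_def)
  qed
  ultimately have "z * powser (diffs (polylog_coeff (Suc m))) z = polylog m z"
    using polylog_sums[of m z] sums_unique2 assms by (metis less_imp_le)
  hence "powser (diffs (polylog_coeff (Suc m))) z = polylog m z / z"
    using assms(3) by (simp add: field_simps)
  thus ?thesis
    using polylog_deriv_powser[of "Suc m" z] assms by simp
qed

lemma polylog3_deriv:
  assumes "norm z < 1" "z \<noteq> 0"
  shows "(polylog 3 has_field_derivative (polylog 2 z / z)) (at z)"
  using polylog_Suc_deriv[of 2 z] assms by (simp add: eval_nat_numeral)

lemma polylog2_1: "polylog 2 1 = of_real pi ^ 2 / 6"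
proof -
  have "(\<lambda>n. complex_of_real (1 / (real n + 1)\<^sup>2)) sums of_real (pi\<^sup>2 / 6)"
    using inverse_squares_sums by (subst sums_of_real_iff) (simp add: add.commute)
  thus ?thesis
    by (simp add: polylog_def sums_iff add.commute)
qed

lemma polylog3_1: "polylog 3 1 = zeta 3"
proof -
  have "of_nat (Suc n) powr (3::complex) = of_nat (Suc n) ^ 3" for n
    using powr_nat'[of "of_nat (Suc n) :: complex" 3] by (simp del: of_nat_Suc)
  thus ?thesis by (simp add: polylog_def zeta_def del: of_nat_Suc)
qed

text \<open>
  In \<open>Li\<^sub>m(1) + Li\<^sub>m(-1)\<close> the terms with odd index cancel, and those with even index form a multiple of
  \<open>Li\<^sub>m(1)\<close> again.
\<close>

lemma polylog_minus_1:
  assumes "m \<ge> 2"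
  shows "polylog m (-1) = (2 / 2 ^ m - 1) * polylog m 1"
proof -
  have "(\<lambda>n. polylog_coeff m n * 1 ^ n + polylog_coeff m n * (-1) ^ n)
          sums (polylog m 1 + polylog m (-1))"
    by (intro sums_add polylog_sums) (use assms in auto)
  also have "?this \<longleftrightarrow> (\<lambda>n. polylog_coeff m (2 * n) * 1 ^ (2 * n) + polylog_coeff m (2 * n) * (-1) ^ (2 * n))
          sums (polylog m 1 + polylog m (-1))"
  proof (rule sums_mono_reindex[symmetric])
    fix n :: nat assume "n \<notin> range ((*) 2)"
    hence "odd n" by (metis evenE rangeI)
    thus "polylog_coeff m n * 1 ^ n + polylog_coeff m n * (-1) ^ n = 0" by simp
  qed (simp add: strict_mono_def)
  also have "(\<lambda>n. polylog_coeff m (2 * n) * 1 ^ (2 * n) + polylog_coeff m (2 * n) * (-1) ^ (2 * n))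
           = (\<lambda>n. 2 / 2 ^ m * (polylog_coeff m n * 1 ^ n))"
    by (auto simp: polylog_coeff_def power_mult_distrib)
  finally have "(\<lambda>n. 2 / 2 ^ m * (polylog_coeff m n * 1 ^ n)) sums (polylog m 1 + polylog m (-1))" .
  moreover have "(\<lambda>n. 2 / 2 ^ m * (polylog_coeff m n * 1 ^ n)) sums (2 / 2 ^ m * polylog m 1)"
    by (intro sums_mult polylog_sums) (use assms in auto)
  ultimately have "polylog m 1 + polylog m (-1) = 2 / 2 ^ m * polylog m 1"
    using sums_unique2 by blast
  thus ?thesis by (simp add: algebra_simps)
qed

section \<open>The function \<open>g\<close>\<close>

text \<open>
  The coefficient at \<open>0\<close> vanishes because it is a division by zero.
\<close>

definition moment_series :: "complex \<Rightarrow> complex" where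
  "moment_series = powser (\<lambda>n. of_real (moment (n - 1) / real n))"

lemma moment_series_coeff_summable: "summable (\<lambda>n. norm (complex_of_real (moment (n - 1) / real n)))"
proof -
  have "norm (moment n / real (Suc n)) \<le> 1 / (real n + 1)\<^sup>2" for n
  proof -
    have "moment n / real (Suc n) \<le> (1 / (real n + 1)) / real (Suc n)"
      by (intro divide_right_mono moment_le) auto
    thus ?thesis using moment_nonneg[of n] by (simp add: power2_eq_square add_ac)
  qed
  hence "summable (\<lambda>n. moment n / real (Suc n))"
    by (intro summable_comparison_test'[OF summable_inverse_Suc_squares, of 0])
  hence "summable (\<lambda>n. norm (complex_of_real (moment (Suc n - 1) / real (Suc n))))"
    using moment_nonneg by (simp only: norm_of_real) simp
  thus ?thesis by (subst (asm) summable_Suc_iff)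
qed

text \<open>
  The derivative is the generating function \<open>\<Sum> a\<^sub>n z\<^sup>n\<close>. By the recursion its product with \<open>1 + z\<close> is
  \<open>a\<^sub>0 + \<Sum> z\<^sup>n / n = log 2 - log (1 - z)\<close>.
\<close>

lemma moment_series_deriv:
  assumes "norm z < 1"
  shows "(moment_series has_field_derivative (ln 2 - ln (1 - z)) / (1 + z)) (at z)"
proof -
  define c where "c = (\<lambda>n. complex_of_real (moment (n - 1) / real n))"
  have diffs: "diffs c n = of_real (moment n)" for n
    by (simp add: diffs_def c_def del: of_nat_Suc)
  have cs: "summable (\<lambda>n. norm (c n))"
    using moment_series_coeff_summable unfolding c_def .
  have 1: "(\<lambda>n. of_real (moment n) * z ^ n) sums powser (diffs c) z"
    using summable_sums[OF powser_deriv(2)[OF cs assms]] unfolding powser_def diffs .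
  have 2: "(\<lambda>n. of_nat n * c n * z ^ n) sums (z * powser (diffs c) z)"
    by (rule powser_deriv_times[OF cs assms])
  have "of_real (moment n) * z ^ n + of_nat n * c n * z ^ n
      = (if n = 0 then ln 2 else 0) + z ^ n / of_nat n" for n
  proof (cases n)
    case (Suc k)
    have "of_real (moment (Suc k)) + of_real (moment k) = (1 / of_nat (Suc k) :: complex)"
      using moment_add_Suc[of k]
      by (metis add.commute of_nat_Suc of_real_1 of_real_add of_real_divide of_real_of_nat_eq)
    moreover have "of_nat (Suc k) * c (Suc k) = of_real (moment k)"
      by (simp add: c_def del: of_nat_Suc)
    ultimately have "of_real (moment n) + of_nat n * c n = 1 / of_nat n"
      by (simp only: Suc)
    thus ?thesis using Suc
      by (simp only: distrib_right[symmetric]) simp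
  qed (simp add: moment_0 complex_ln_2)
  with sums_add[OF 1 2]
  have "(\<lambda>n. (if n = 0 then ln 2 else 0) + z ^ n / of_nat n) sums ((1 + z) * powser (diffs c) z)"
    by (simp add: algebra_simps)
  moreover have "(\<lambda>n. (if n = 0 then ln 2 else 0) + z ^ n / of_nat n) sums (ln 2 + - ln (1 - z))"
    by (intro sums_add minus_Ln_sums assms sums_single)
  ultimately have "(1 + z) * powser (diffs c) z = ln 2 - ln (1 - z)"
    using sums_unique2 by fastforce
  moreover have "1 + z \<noteq> 0"
    using assms by (metis add.commute add_eq_0_iff norm_minus_cancel norm_one order_less_irrefl)
  ultimately have "powser (diffs c) z = (ln 2 - ln (1 - z)) / (1 + z)"
    by (simp add: field_simps)
  thus ?thesis
    using powser_deriv(1)[OF cs assms] by (simp add: moment_series_def c_def)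
qed

lemma Ln_half:
  assumes "z \<noteq> 0"
  shows "ln (z / 2) = ln z - ln (2::complex)"
  using Ln_divide_of_real[of 2 z] assms by (simp add: complex_ln_2)

lemma norm_half_1_plus:
  assumes "norm (z::complex) < 1"
  shows "norm ((1 + z) / 2) < 1" "(1 + z) / 2 \<noteq> 0" "1 + z \<noteq> 0"
proof -
  show "1 + z \<noteq> 0"
    using assms by (metis add.commute add_eq_0_iff norm_minus_cancel norm_one order_less_irrefl)
  have "norm (1 + z) < 2"
    using norm_triangle_ineq[of 1 z] assms by simp
  thus "norm ((1 + z) / 2) < 1" by (simp add: norm_divide)
  show "(1 + z) / 2 \<noteq> 0" using \<open>1 + z \<noteq> 0\<close> by simp
qed

lemma polylog2_half_plus_deriv:
  assumes "norm z < 1"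
  shows "((\<lambda>z. polylog 2 ((1 + z) / 2)) has_field_derivative (ln 2 - ln (1 - z)) / (1 + z)) (at z)"
proof -
  have d: "((\<lambda>z. (1 + z) / 2) has_field_derivative 1 / 2) (at z)"
    by (auto intro!: derivative_eq_intros)
  have "ln (1 - (1 + z) / 2) = ln ((1 - z) / 2)"
    by (simp add: field_simps)
  also have "\<dots> = ln (1 - z) - ln 2"
    using norm_half_1_plus(3)[of "-z"] assms by (intro Ln_half) auto
  finally have ln: "ln (1 - (1 + z) / 2) = ln (1 - z) - ln 2" .
  have "a / (w / 2) * (1 / 2) = a / w" for a w :: complex
    by simp
  hence eq: "- ln (1 - (1 + z) / 2) / ((1 + z) / 2) * (1 / 2) = (ln 2 - ln (1 - z)) / (1 + z)"
    by (simp only: ln minus_diff_eq)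
  show ?thesis
    using DERIV_chain2[OF polylog2_deriv[OF norm_half_1_plus(1,2)[OF assms]] d]
    unfolding eq .
qed

lemma half_1_plus_mem:
  assumes "norm (z::complex) \<le> 1"
  shows "(1 + z) / 2 \<in> cball 0 1"
  using norm_triangle_ineq[of 1 z] assms by (simp add: norm_divide)

lemma polylog_half_continuous:
  assumes "m \<ge> 2"
  shows "continuous_on (cball 0 1) (\<lambda>z. polylog m ((1 + z) / 2))"
    and "continuous_on (cball 0 1) (\<lambda>z. polylog m ((1 - z) / 2))"
proof -
  show 1: "continuous_on (cball 0 1) (\<lambda>z. polylog m ((1 + z) / 2))"
    by (rule continuous_on_compose2[OF polylog_continuous[OF assms]])
       (use half_1_plus_mem in \<open>auto intro!: continuous_intros\<close>)
  have "continuous_on (cball 0 1) (\<lambda>z. polylog m ((1 + (- z)) / 2))"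
    by (rule continuous_on_compose2[OF 1]) (auto intro!: continuous_intros)
  thus "continuous_on (cball 0 1) (\<lambda>z. polylog m ((1 - z) / 2))" by simp
qed

text \<open>
  Both sides have the same derivative in the open disk and agree at \<open>0\<close>; continuity carries the
  identity to the circle.
\<close>

lemma moment_series_eq:
  assumes "norm z \<le> 1"
  shows "moment_series z = polylog 2 ((1 + z) / 2) - polylog 2 (1 / 2)"
proof -
  have q0: "moment_series 0 = 0" by (simp add: moment_series_def powser_0)
  have const: "\<exists>c. \<forall>z\<in>ball 0 1. moment_series z - polylog 2 ((1 + z) / 2) = c"
  proof (rule has_field_derivative_zero_constant)
    fix z :: complex assume z: "z \<in> ball 0 1"
    show "((\<lambda>z. moment_series z - polylog 2 ((1 + z) / 2)) has_field_derivative 0) (at z within ball 0 1)"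
      using DERIV_diff[OF moment_series_deriv polylog2_half_plus_deriv, of z] z
      by (simp add: has_field_derivative_at_within)
  qed simp
  have inside: "moment_series z - polylog 2 ((1 + z) / 2) = - polylog 2 (1 / 2)" if "z \<in> ball 0 1" for z
  proof -
    obtain c where c: "\<forall>z\<in>ball 0 1. moment_series z - polylog 2 ((1 + z) / 2) = c" using const by blast
    have "moment_series 0 - polylog 2 ((1 + 0) / 2) = c" by (rule bspec[OF c]) simp
    with c that q0 show ?thesis by simp
  qed
  have "continuous_on (closure (ball 0 1)) (\<lambda>z. moment_series z - polylog 2 ((1 + z) / 2))"
    using continuous_on_diff[OF powser_continuous[OF moment_series_coeff_summable] polylog_half_continuous(1)[of 2]]
    by (simp add: moment_series_def)
  from continuous_constant_on_closure[OF this inside, of z]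
  have "moment_series z - polylog 2 ((1 + z) / 2) = - polylog 2 (1 / 2)"
    using assms by simp
  thus ?thesis by (simp add: algebra_simps)
qed

definition g_coeff :: "nat \<Rightarrow> complex" where
  "g_coeff n = of_real ((moment n)\<^sup>2)"

lemma g_coeff_summable: "summable (\<lambda>n. norm (g_coeff n))"
  using summable_moment_sq by (simp add: g_coeff_def norm_power)

definition G_coeff :: "nat \<Rightarrow> complex" where
  "G_coeff n = of_real ((moment (n - 1))\<^sup>2 / real n)"

lemma G_coeff_summable: "summable (\<lambda>n. norm (G_coeff n))"
proof -
  have "summable (\<lambda>n. (moment n)\<^sup>2 / real (Suc n))"
    by (rule summable_comparison_test'[OF summable_moment_sq, of 0])
       (auto simp: divide_le_eq mult_le_cancel_left1)
  hence "summable (\<lambda>n. norm (G_coeff (Suc n)))"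
    unfolding G_coeff_def norm_of_real by simp
  thus ?thesis by (subst (asm) summable_Suc_iff)
qed

lemma g_eq_powser: "norm z \<le> 1 \<Longrightarrow> g z = powser g_coeff z"
  using g_power_series(2)[of z] by (simp add: powser_def g_coeff_def sums_iff)

lemma G_eq_powser:
  assumes "norm z \<le> 1"
  shows "G z = powser G_coeff z"
proof -
  have "(\<lambda>n. G_coeff (Suc n) * z ^ Suc n) sums G z"
    using G_power_series(2)[OF assms] by (simp only: G_coeff_def diff_Suc_1)
  hence "(\<lambda>n. G_coeff n * z ^ n) sums G z"
    by (subst (asm) sums_Suc_iff) (simp add: G_coeff_def)
  thus ?thesis by (simp add: powser_def sums_iff)
qed

lemma g_continuous: "continuous_on (cball 0 1) g"
  using powser_continuous[OF g_coeff_summable]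
  by (subst continuous_on_cong[OF refl g_eq_powser]) auto

lemma G_continuous: "continuous_on (cball 0 1) G"
  using powser_continuous[OF G_coeff_summable]
  by (subst continuous_on_cong[OF refl G_eq_powser]) auto

lemma G_0: "G 0 = 0"
  by (simp add: G_eq_powser powser_0 G_coeff_def)

lemma G_deriv:
  assumes "norm z < 1"
  shows "(G has_field_derivative g z) (at z)"
proof -
  have "diffs G_coeff = g_coeff"
    by (auto simp: diffs_def G_coeff_def g_coeff_def simp del: of_nat_Suc)
  hence "(powser G_coeff has_field_derivative g z) (at z)"
    using powser_deriv(1)[OF G_coeff_summable assms] assms by (simp add: g_eq_powser)
  thus ?thesis
    by (rule has_field_derivative_transform_within_open[of _ _ _ "ball 0 1"])
       (use assms in \<open>auto simp: G_eq_powser\<close>)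
qed

text \<open>
  Comparison of coefficients: substituting \<open>a\<^sub>n = 1 / n - a\<^sub>n\<^sub>-\<^sub>1\<close> in \<open>a\<^sub>n\<^sup>2 - a\<^sub>n\<^sub>-\<^sub>1\<^sup>2\<close> cancels the squares.
\<close>

lemma g_functional_equation:
  assumes "norm z \<le> 1"
  shows "(1 - z) * g z = polylog 2 z + (ln 2)\<^sup>2 - 2 * moment_series z"
proof -
  have g: "(\<lambda>n. g_coeff n * z ^ n) sums g z"
    using powser_sums[OF g_coeff_summable assms] g_eq_powser[OF assms] by simp
  have zg: "(\<lambda>n. (if n = 0 then 0 else g_coeff (n - 1)) * z ^ n) sums (z * g z)"
    using sums_Suc[of "\<lambda>n. (if n = 0 then 0 else g_coeff (n - 1)) * z ^ n"] sums_mult[OF g, of z]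
    by (simp add: mult_ac)
  have coeff0: "g_coeff n - (if n = 0 then 0 else g_coeff (n - 1)) =
        (if n = 0 then (ln 2)\<^sup>2 else 0) + polylog_coeff 2 n
          - 2 * of_real (moment (n - 1) / real n)" for n
  proof (cases n)
    case (Suc k)
    have s: "moment (Suc k) = 1 / real (Suc k) - moment k"
      using moment_add_Suc[of k] by (simp add: add.commute)
    have "(moment (Suc k))\<^sup>2 - (moment k)\<^sup>2 = 1 / (real (Suc k))\<^sup>2 - 2 * (moment k / real (Suc k))"
      unfolding s by (simp add: power2_eq_square algebra_simps del: of_nat_Suc)
    hence "complex_of_real ((moment (Suc k))\<^sup>2 - (moment k)\<^sup>2) =
           of_real (1 / (real (Suc k))\<^sup>2 - 2 * (moment k / real (Suc k)))"
      by (rule arg_cong)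
    thus ?thesis
      by (simp add: Suc g_coeff_def polylog_coeff_def del: of_nat_Suc)
  qed (simp add: g_coeff_def polylog_coeff_def moment_0 complex_ln_2)
  have coeff: "g_coeff n * z ^ n - (if n = 0 then 0 else g_coeff (n - 1)) * z ^ n =
        (if n = 0 then (ln 2)\<^sup>2 else 0) + polylog_coeff 2 n * z ^ n
          - 2 * (of_real (moment (n - 1) / real n) * z ^ n)" for n
    unfolding left_diff_distrib[symmetric] coeff0
    by (cases "n = 0") (auto simp: algebra_simps)
  have "(\<lambda>n. g_coeff n * z ^ n - (if n = 0 then 0 else g_coeff (n - 1)) * z ^ n) sums (g z - z * g z)"
    by (intro sums_diff g zg)
  moreover have "(\<lambda>n. (if n = 0 then (ln 2)\<^sup>2 else 0) + polylog_coeff 2 n * z ^ n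
          - 2 * (of_real (moment (n - 1) / real n) * z ^ n)) sums ((ln 2)\<^sup>2 + polylog 2 z - 2 * moment_series z)"
    unfolding moment_series_def
    by (intro sums_diff sums_add sums_mult polylog_sums powser_sums moment_series_coeff_summable sums_single assms) simp
  ultimately have "g z - z * g z = (ln 2)\<^sup>2 + polylog 2 z - 2 * moment_series z"
    unfolding coeff using sums_unique2 by blast
  thus ?thesis by (simp add: algebra_simps)
qed

lemma g_eq_g_closed:
  assumes "norm z \<le> 1" "z \<noteq> 1"
  shows "g z = g_closed z"
proof -
  have "g z = 1 / (1 - z) * ((1 - z) * g z)"
    using assms(2) by simp
  also have "\<dots> = g_closed z"
    unfolding g_functional_equation[OF assms(1)] moment_series_eq[OF assms(1)] g_closed_def ..
  finally show ?thesis .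
qed

lemma g_1: "g 1 = ln 2"
proof -
  have "(\<lambda>n. complex_of_real ((moment n)\<^sup>2)) sums of_real (ln 2)"
    using moment_sq_sums by (subst sums_of_real_iff)
  thus ?thesis
    using sums_unique2[OF g_power_series(2)[of 1]] by (simp add: complex_ln_2)
qed

text \<open>
  At \<open>z = 1\<close> the left-hand side of the functional equation vanishes, and the right-hand side involves
  only \<open>Li\<^sub>2(1)\<close> and \<open>Li\<^sub>2(1/2)\<close>.
\<close>

lemma polylog2_half: "polylog 2 (1 / 2) = of_real pi ^ 2 / 12 - (ln 2)\<^sup>2 / 2"
proof -
  have "0 = polylog 2 1 + (ln 2)\<^sup>2 - 2 * (polylog 2 1 - polylog 2 (1 / 2))"
    using g_functional_equation[of 1] moment_series_eq[of 1] by simp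
  hence "2 * polylog 2 (1 / 2) = polylog 2 1 - (ln 2)\<^sup>2"
    by (simp add: algebra_simps)
  hence "polylog 2 (1 / 2) = (polylog 2 1 - (ln 2)\<^sup>2) / 2"
    by (simp add: mult.commute)
  thus ?thesis by (simp add: polylog2_1 diff_divide_distrib)
qed

lemma g_minus_1: "g (-1) = of_real pi ^ 2 / 24"
proof -
  have "polylog 2 (-1) = - (of_real pi ^ 2 / 12)"
    using polylog_minus_1[of 2] by (simp add: polylog2_1)
  hence "2 * g (-1) = - (of_real pi ^ 2 / 12) + (ln 2)\<^sup>2 + 2 * polylog 2 (1 / 2)"
    using g_functional_equation[of "-1"] moment_series_eq[of "-1"] by simp
  also have "\<dots> = 2 * (of_real pi ^ 2 / 24)"
    by (simp add: polylog2_half)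
  finally show ?thesis by (simp add: mult.commute)
qed

lemma g_closed_tendsto_1: "(g_closed \<longlongrightarrow> g 1) (at 1 within cball 0 1)"
proof -
  have "(g \<longlongrightarrow> g 1) (at 1 within cball 0 1)"
    using g_continuous by (auto simp: continuous_on_def)
  thus ?thesis
    by (rule Lim_transform_eventually)
       (auto simp: eventually_at_filter g_eq_g_closed intro!: always_eventually)
qed

section \<open>The closed form of \<open>G\<close>\<close>

lemma one_minus_notin_nonpos_Reals:
  assumes "norm (z::complex) \<le> 1" "z \<noteq> 1"
  shows "1 - z \<notin> \<real>\<^sub>\<le>\<^sub>0"
proof
  assume "1 - z \<in> \<real>\<^sub>\<le>\<^sub>0"
  hence z: "Im z = 0" "Re z \<ge> 1" by (auto simp: complex_nonpos_Reals_iff)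
  with assms(1) abs_Re_le_cmod[of z] have "Re z = 1" by linarith
  with z assms(2) show False by (simp add: complex_eq_iff)
qed

lemma one_plus_notin_nonpos_Reals:
  assumes "norm (z::complex) \<le> 1" "z \<noteq> -1"
  shows "1 + z \<notin> \<real>\<^sub>\<le>\<^sub>0"
  using one_minus_notin_nonpos_Reals[of "-z"] assms by (auto simp: minus_equation_iff)

text \<open>
  Split off from the contour integral, which the fundamental theorem of calculus recovers from the
  derivative of this part.
\<close>

definition G_explicit :: "complex \<Rightarrow> complex" where
  "G_explicit z =
     ln (1 - z) * (2 * polylog 2 ((1 + z) / 2) - of_real pi ^ 2 / 6)
     + 2 * ln (1 + z) * ((ln (1 - z))\<^sup>2 - (ln 2)\<^sup>2)
     + 2 * ln 2 * (polylog 2 ((1 + z) / 2) - polylog 2 (1 / 2))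
     - 2 * ln 2 * (ln (1 - z))\<^sup>2
     + 4 * ln (1 - z) * polylog 2 ((1 - z) / 2)
     - 4 * (polylog 3 ((1 - z) / 2) - polylog 3 (1 / 2))"

lemma G_closed_eq:
  "G_closed z = contour_integral (linepath 0 z) (\<lambda>t. polylog 2 t / (1 - t)) + G_explicit z"
  by (simp add: G_closed_def G_explicit_def)

lemma polylog2_half_minus_deriv:
  assumes "norm z < 1"
  shows "((\<lambda>z. polylog 2 ((1 - z) / 2)) has_field_derivative (ln (1 + z) - ln 2) / (1 - z)) (at z)"
proof -
  have "((\<lambda>z. polylog 2 ((1 + - z) / 2)) has_field_derivative
          (ln 2 - ln (1 - - z)) / (1 + - z) * - 1) (at z)"
  proof (rule DERIV_chain2[where f = "\<lambda>z. polylog 2 ((1 + z) / 2)"])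
    show "((\<lambda>z. polylog 2 ((1 + z) / 2)) has_field_derivative (ln 2 - ln (1 - - z)) / (1 + - z)) (at (- z))"
      using polylog2_half_plus_deriv[of "-z"] assms by simp
  qed (auto intro!: derivative_eq_intros)
  moreover have "(ln 2 - ln (1 - - z)) / (1 + - z) * - 1 = (ln (1 + z) - ln 2) / (1 - z)"
    by (simp add: minus_divide_left del: minus_divide_left[symmetric])
  ultimately show ?thesis by simp
qed

lemma polylog3_half_minus_deriv:
  assumes "norm z < 1"
  shows "((\<lambda>z. polylog 3 ((1 - z) / 2)) has_field_derivative
            - polylog 2 ((1 - z) / 2) / (1 - z)) (at z)"
proof -
  have d: "((\<lambda>z. (1 - z) / 2) has_field_derivative - 1 / 2) (at z)"
    by (auto intro!: derivative_eq_intros)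
  have "norm ((1 - z) / 2) < 1" "(1 - z) / 2 \<noteq> 0"
    using norm_half_1_plus[of "-z"] assms by auto
  note chain = DERIV_chain2[OF polylog3_deriv[OF this] d]
  have "a / (w / 2) * (- 1 / 2) = - a / w" for a w :: complex
    by simp
  from chain[unfolded this] show ?thesis .
qed

lemma Ln_one_minus_deriv:
  assumes "1 - z \<notin> \<real>\<^sub>\<le>\<^sub>0"
  shows "((\<lambda>z. ln (1 - z)) has_field_derivative - inverse (1 - z)) (at (z::complex))"
  using assms by (auto intro!: derivative_eq_intros simp: divide_inverse)

lemma Ln_one_plus_deriv:
  assumes "1 + z \<notin> \<real>\<^sub>\<le>\<^sub>0"
  shows "((\<lambda>z. ln (1 + z)) has_field_derivative inverse (1 + z)) (at (z::complex))"
  using assms by (auto intro!: derivative_eq_intros simp: divide_inverse)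

lemma unit_disk_not_pm1:
  assumes "norm (z::complex) < 1"
  shows "z \<noteq> 1" "z \<noteq> -1"
  using assms by auto

text \<open>
  All terms with denominator \<open>1 + z\<close> cancel. Those with denominator \<open>1 - z\<close> leave
  \<open>\<pi>\<^sup>2/6 - 2 Li\<^sub>2((1 + z)/2)\<close>, and this is the numerator of the closed form of \<open>g\<close> without \<open>Li\<^sub>2(z)\<close>
  by the value of \<open>Li\<^sub>2(1/2)\<close>.
\<close>

lemma G_explicit_deriv:
  assumes "norm z < 1"
  shows "(G_explicit has_field_derivative (g z - polylog 2 z / (1 - z))) (at z)"
proof -
  have z: "norm z \<le> 1" "z \<noteq> 1" "z \<noteq> -1"
    using assms unit_disk_not_pm1[of z] by auto
  \<comment> \<open>Naming the reciprocals and the transcendental values turns the final comparison into a polynomial identity.\<close>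
  define u where "u = inverse (1 - z)"
  define v where "v = inverse (1 + z)"
  define h :: complex where "h = ln 2"
  define L where "L = ln (1 - z)"
  define P where "P = ln (1 + z)"
  define A where "A = polylog 2 ((1 + z) / 2)"
  define B where "B = polylog 2 ((1 - z) / 2)"
  have dL: "((\<lambda>z. ln (1 - z)) has_field_derivative - u) (at z)"
    unfolding u_def by (rule Ln_one_minus_deriv[OF one_minus_notin_nonpos_Reals[OF z(1,2)]])
  have dP: "((\<lambda>z. ln (1 + z)) has_field_derivative v) (at z)"
    unfolding v_def by (rule Ln_one_plus_deriv[OF one_plus_notin_nonpos_Reals[OF z(1,3)]])
  have dA: "((\<lambda>z. polylog 2 ((1 + z) / 2)) has_field_derivative (h - L) * v) (at z)"
    using polylog2_half_plus_deriv[OF assms] unfolding divide_inverse v_def h_def L_def .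
  have dB: "((\<lambda>z. polylog 2 ((1 - z) / 2)) has_field_derivative (P - h) * u) (at z)"
    using polylog2_half_minus_deriv[OF assms] unfolding divide_inverse u_def h_def P_def .
  have dT: "((\<lambda>z. polylog 3 ((1 - z) / 2)) has_field_derivative - B * u) (at z)"
    using polylog3_half_minus_deriv[OF assms] unfolding divide_inverse u_def B_def .
  have dL2: "((\<lambda>z. (ln (1 - z))\<^sup>2) has_field_derivative - 2 * L * u) (at z)"
    using DERIV_power[OF dL, of 2] by (simp add: L_def mult_ac)
  have target: "g z - polylog 2 z / (1 - z) = u * (of_real pi ^ 2 / 6 - 2 * A)"
  proof -
    have "u * (X + h\<^sup>2 - 2 * (A - (c / 12 - h\<^sup>2 / 2))) - X * u = u * (c / 6 - 2 * A)"
      for X c :: complex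
      by (simp add: algebra_simps)
    moreover have "1 / (1 - z) = u" "polylog 2 z / (1 - z) = polylog 2 z * u"
      by (simp_all add: u_def divide_simps)
    ultimately show ?thesis
      by (simp only: g_eq_g_closed[OF z(1,2)] g_closed_def polylog2_half flip: h_def A_def)
  qed
  show ?thesis
    unfolding G_explicit_def target
  proof (rule DERIV_cong)
    show "((\<lambda>z. ln (1 - z) * (2 * polylog 2 ((1 + z) / 2) - of_real pi ^ 2 / 6)
     + 2 * ln (1 + z) * ((ln (1 - z))\<^sup>2 - (ln 2)\<^sup>2)
     + 2 * ln 2 * (polylog 2 ((1 + z) / 2) - polylog 2 (1 / 2))
     - 2 * ln 2 * (ln (1 - z))\<^sup>2
     + 4 * ln (1 - z) * polylog 2 ((1 - z) / 2)
     - 4 * (polylog 3 ((1 - z) / 2) - polylog 3 (1 / 2))) has_field_derivative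
       (- u * (2 * A - of_real pi ^ 2 / 6) + (2 * ((h - L) * v) - 0) * L
     + (2 * v * (L\<^sup>2 - h\<^sup>2) + (- 2 * L * u - 0) * (2 * P))
     + 2 * h * ((h - L) * v - 0)
     - 2 * h * (- 2 * L * u)
     + (4 * - u * B + (P - h) * u * (4 * L))
     - 4 * (- B * u - 0))) (at z)"
      unfolding h_def A_def B_def L_def P_def
      by (rule DERIV_const DERIV_cmult DERIV_add DERIV_diff DERIV_mult
          dL[unfolded h_def A_def B_def L_def P_def] dP[unfolded h_def A_def B_def L_def P_def]
          dA[unfolded h_def A_def B_def L_def P_def] dB[unfolded h_def A_def B_def L_def P_def]
          dT[unfolded h_def A_def B_def L_def P_def] dL2[unfolded h_def A_def B_def L_def P_def])+
  qed (simp add: algebra_simps power2_eq_square)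
qed

lemma G_explicit_continuous: "continuous_on (cball 0 1 - {1, -1}) G_explicit"
proof -
  have sub: "cball 0 1 - {1, -1} \<subseteq> cball (0::complex) 1" by auto
  have ln: "continuous_on (cball 0 1 - {1, -1}) (\<lambda>z::complex. ln (1 - z))"
    using one_minus_notin_nonpos_Reals by (intro continuous_on_Ln continuous_intros) auto
  have ln': "continuous_on (cball 0 1 - {1, -1}) (\<lambda>z::complex. ln (1 + z))"
    using one_plus_notin_nonpos_Reals by (intro continuous_on_Ln continuous_intros) auto
  note cont = polylog_half_continuous[THEN continuous_on_subset, OF _ sub]
  show ?thesis
    unfolding G_explicit_def
    by (intro continuous_on_add continuous_on_diff continuous_on_mult continuous_on_const
              continuous_on_power ln ln' cont) auto
qed

lemma G_explicit_0: "G_explicit 0 = 0"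
  by (simp add: G_explicit_def)

lemma G_eq_G_closed:
  assumes "norm z \<le> 1" "z \<noteq> 1" "z \<noteq> -1"
  shows "G z = G_closed z"
proof -
  define D where "D = (\<lambda>z. G z - G_explicit z)"
  have "(\<lambda>s. polylog 2 (linepath 0 z s) / (1 - linepath 0 z s) * (z - 0))
          = (\<lambda>s. z * (polylog 2 (of_real s * z) / (1 - of_real s * z)))"
    by (simp add: linepath_def scaleR_conv_of_real fun_eq_iff)
  moreover have "((\<lambda>s. z * (polylog 2 (of_real s * z) / (1 - of_real s * z)))
        has_integral (D (of_real 1 * z) - D (of_real 0 * z))) {0..1}"
  proof (rule fundamental_theorem_of_calculus_interior)
    \<comment> \<open>The segment can meet \<open>1\<close> or \<open>-1\<close> only in its end point \<open>z\<close>, which is neither.\<close>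
    have "of_real s * z \<in> cball 0 1 - {1, -1}" if s: "s \<in> {0..1}" for s
    proof -
      have le: "norm (of_real s * z) \<le> norm z" "norm (of_real s * z) = s * norm z"
        using s by (auto simp: norm_mult mult_left_le_one_le)
      have "s = 1" if "norm (of_real s * z) = 1"
        using that le s assms(1)
        by (metis atLeastAtMost_iff linorder_not_le mult_less_cancel_right2 mult_right_le_one_le
              norm_ge_zero order_antisym)
      hence "of_real s * z = 1 \<Longrightarrow> s = 1" "of_real s * z = -1 \<Longrightarrow> s = 1"
        by (metis norm_one, metis norm_minus_cancel norm_one)
      with le assms show ?thesis by auto
    qed
    moreover have "continuous_on (cball 0 1 - {1, -1}) D"
      unfolding D_def
      by (intro continuous_on_diff G_explicit_continuous continuous_on_subset[OF G_continuous]) auto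
    ultimately show "continuous_on {0..1} (\<lambda>s. D (of_real s * z))"
      by (intro continuous_on_compose2[of _ D "{0..1}" "\<lambda>s. of_real s * z"])
         (auto intro!: continuous_intros)
    show "((\<lambda>s. D (of_real s * z)) has_vector_derivative
             z * (polylog 2 (of_real s * z) / (1 - of_real s * z))) (at s)"
      if s: "s \<in> {0<..<1}" for s
    proof -
      have "norm (of_real s * z) \<le> s"
        using s assms(1) by (simp add: norm_mult mult_left_le)
      hence "norm (of_real s * z) < 1" using s by simp
      hence "(D has_field_derivative (g (of_real s * z) -
               (g (of_real s * z) - polylog 2 (of_real s * z) / (1 - of_real s * z)))) (at (of_real s * z))"
        unfolding D_def by (intro DERIV_diff G_deriv G_explicit_deriv)
      hence d: "(D has_field_derivative (polylog 2 (of_real s * z) / (1 - of_real s * z)))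
              (at (of_real s * z))"
        by simp
      have "((\<lambda>s. of_real s * z) has_vector_derivative z) (at s)"
        by (auto intro!: derivative_eq_intros simp: has_vector_derivative_def scaleR_conv_of_real)
      from field_vector_diff_chain_at[OF this d] show ?thesis
        by (simp add: o_def)
    qed
  qed simp
  ultimately have "((\<lambda>t. polylog 2 t / (1 - t)) has_contour_integral (D z - D 0)) (linepath 0 z)"
    unfolding has_contour_integral_linepath by simp
  hence "contour_integral (linepath 0 z) (\<lambda>t. polylog 2 t / (1 - t)) = D z - D 0"
    by (rule contour_integral_unique)
  thus ?thesis
    unfolding G_closed_eq by (simp add: D_def G_0 G_explicit_0)
qed

lemma G_closed_tendsto:
  assumes "w = 1 \<or> w = -1"
  shows "(G_closed \<longlongrightarrow> G w) (at w within cball 0 1)"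
proof (rule Lim_transform_eventually)
  have "norm w = 1" using assms by (metis norm_minus_cancel norm_one)
  hence "w \<in> cball 0 1" by simp
  thus "(G \<longlongrightarrow> G w) (at w within cball 0 1)"
    using G_continuous unfolding continuous_on_def by blast
  have "w \<noteq> - w"
    using assms by (elim disjE) simp_all
  hence "\<forall>\<^sub>F z in nhds w. z \<noteq> - w"
    by (rule t1_space_nhds)
  thus "\<forall>\<^sub>F z in at w within cball 0 1. G z = G_closed z"
    unfolding eventually_at_filter
  proof eventually_elim
    case (elim z)
    show ?case
    proof (intro impI)
      assume "z \<noteq> w" "z \<in> cball 0 1"
      hence "norm z \<le> 1" "z \<noteq> 1 \<and> z \<noteq> -1"
        using elim assms by (simp, metis minus_minus)
      thus "G z = G_closed z" by (blast intro: G_eq_G_closed)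
    qed
  qed
qed


section \<open>Comparing limits along real intervals\<close>

lemma constant_on_interval:
  fixes F :: "complex \<Rightarrow> complex"
  assumes deriv: "\<And>x. a < x \<Longrightarrow> x < b \<Longrightarrow> (F has_field_derivative 0) (at (of_real x))"
    and lim: "((\<lambda>x. F (of_real x)) \<longlongrightarrow> c) (at_right a)"
    and x: "a < x" "x < b"
  shows "F (of_real x) = c"
proof -
  have "\<exists>k. \<forall>x\<in>{a<..<b}. F (of_real x) = k"
  proof (rule has_vector_derivative_zero_constant)
    show "((\<lambda>x. F (of_real x)) has_vector_derivative 0) (at x within {a<..<b})"
      if "x \<in> {a<..<b}" for x
      using has_vector_derivative_real_field[OF deriv] that by auto
  qed auto
  then obtain k where k: "\<And>x. a < x \<Longrightarrow> x < b \<Longrightarrow> F (of_real x) = k"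
    by (meson greaterThanLessThan_iff)
  have "\<forall>\<^sub>F x in at_right a. F (of_real x) = k"
    using x by (intro eventually_at_rightI[of a b]) (auto intro: k)
  hence "((\<lambda>x. F (of_real x)) \<longlongrightarrow> k) (at_right a)"
    by (rule tendsto_eventually)
  hence "k = c"
    using lim by (intro tendsto_unique[of "at_right a"]) auto
  with k x show ?thesis by simp
qed

text \<open>
  Functional equations and special values are obtained in this form: a combination of polylogarithms
  and logarithms has derivative zero on a real interval, and its limits at the two ends are compared.
\<close>

lemma limits_agree:
  fixes F :: "complex \<Rightarrow> complex"
  assumes "a < b"
    and "\<And>x. a < x \<Longrightarrow> x < b \<Longrightarrow> (F has_field_derivative 0) (at (of_real x))"
    and "((\<lambda>x. F (of_real x)) \<longlongrightarrow> c) (at_right a)"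
    and "((\<lambda>x. F (of_real x)) \<longlongrightarrow> d) (at_left b)"
  shows "c = d"
proof -
  have "F (of_real x) = c" if "a < x" "x < b" for x
    using assms(2,3) that by (rule constant_on_interval)
  hence "\<forall>\<^sub>F x in at_left b. F (of_real x) = c"
    using assms(1) by (intro eventually_at_leftI[of a b]) auto
  hence "((\<lambda>x. F (of_real x)) \<longlongrightarrow> c) (at_left b)"
    by (rule tendsto_eventually)
  thus ?thesis
    using assms(4) by (intro tendsto_unique[of "at_left b"]) auto
qed

lemma polylog_tendsto:
  assumes "m \<ge> 2" "(f \<longlongrightarrow> w) F" "norm w \<le> 1" "\<forall>\<^sub>F x in F. norm (f x) \<le> 1"
  shows "((\<lambda>x. polylog m (f x)) \<longlongrightarrow> polylog m w) F"
proof (rule continuous_on_tendsto_compose[OF polylog_continuous[OF assms(1)] assms(2)])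
  show "w \<in> cball 0 1" using assms(3) by simp
  show "\<forall>\<^sub>F x in F. f x \<in> cball 0 1" using assms(4) by simp
qed

text \<open>
  The power series has a factor \<open>w\<close>; the cofactor is at most \<open>\<Sum> 1 / n\<^sup>2\<close>.
\<close>

lemma norm_polylog2_le:
  assumes "norm w \<le> 1"
  shows "norm (polylog 2 w) \<le> pi\<^sup>2 / 6 * norm w"
proof -
  have s: "(\<lambda>n. norm w * (1 / (real n + 1)\<^sup>2)) sums (norm w * (pi\<^sup>2 / 6))"
    using inverse_squares_sums by (intro sums_mult) (simp add: add.commute)
  have "norm (w ^ Suc n / of_nat (Suc n) ^ 2) \<le> norm w * (1 / (real n + 1)\<^sup>2)" for n
  proof -
    have "norm w ^ Suc n \<le> norm w ^ 1"
      using assms by (intro power_decreasing) auto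
    hence "norm w ^ Suc n / (real n + 1)\<^sup>2 \<le> norm w / (real n + 1)\<^sup>2"
      by (intro divide_right_mono) auto
    moreover have "norm (of_nat (Suc n) :: complex) = real n + 1"
      by (simp only: norm_of_nat)
    ultimately show ?thesis
      by (simp only: norm_divide norm_power) simp
  qed
  from norm_suminf_le[OF this sums_summable[OF s]] show ?thesis
    using sums_unique[OF s] unfolding polylog_def by (simp add: mult.commute)
qed

text \<open>
  The dilogarithm is dominated by its argument, so an unbounded factor \<open>f\<close> is harmless as soon as it
  is harmless in front of \<open>w\<close>.
\<close>

lemma tendsto_times_polylog2_0:
  fixes f w :: "real \<Rightarrow> complex"
  assumes "((\<lambda>x. f x * w x) \<longlongrightarrow> 0) F" "\<forall>\<^sub>F x in F. norm (w x) \<le> 1"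
  shows "((\<lambda>x. f x * polylog 2 (w x)) \<longlongrightarrow> 0) F"
proof (rule Lim_null_comparison)
  show "\<forall>\<^sub>F x in F. norm (f x * polylog 2 (w x)) \<le> pi\<^sup>2 / 6 * norm (f x * w x)"
    using assms(2)
  proof eventually_elim
    case (elim x)
    thus ?case
      using mult_left_mono[OF norm_polylog2_le[OF elim], of "norm (f x)"]
      by (simp add: norm_mult mult_ac)
  qed
  show "((\<lambda>x. pi\<^sup>2 / 6 * norm (f x * w x)) \<longlongrightarrow> 0) F"
    using tendsto_mult_right_zero[OF tendsto_norm_zero[OF assms(1)]] .
qed

lemma tendsto_complex_of_real_transform:
  fixes f :: "real \<Rightarrow> complex" and r :: "real \<Rightarrow> real"
  assumes "(r \<longlongrightarrow> c) F" "\<forall>\<^sub>F x in F. f x = of_real (r x)"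
  shows "(f \<longlongrightarrow> of_real c) F"
  using tendsto_of_real[OF assms(1), where 'a = complex] assms(2)
  by (simp add: tendsto_cong)


lemma eventually_at_right_0I:
  "(\<And>x. 0 < x \<Longrightarrow> x < 1 \<Longrightarrow> P x) \<Longrightarrow> eventually P (at_right (0::real))"
  by (rule eventually_at_rightI[of 0 1]) auto

lemma eventually_at_left_1I:
  "(\<And>x. 0 < x \<Longrightarrow> x < 1 \<Longrightarrow> P x) \<Longrightarrow> eventually P (at_left (1::real))"
  by (rule eventually_at_leftI[of 0 1]) auto

lemma Ln_one_minus_of_real: "x < 1 \<Longrightarrow> ln (1 - complex_of_real x) = of_real (ln (1 - x))"
  using Ln_of_real[of "1 - x"] by simp

lemma Ln_one_plus_of_real: "-1 < x \<Longrightarrow> ln (1 + complex_of_real x) = of_real (ln (1 + x))"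
  using Ln_of_real[of "1 + x"] by simp

section \<open>Functional equations and the value at one half\<close>

text \<open>
  Each argument \<open>f\<close> below has a logarithmic derivative \<open>r = f' / f\<close> which is a sum of simple fractions.
  In terms of \<open>r\<close> the chain rule for polylogarithms involves no further denominators.
\<close>

lemma polylog2_chain:
  assumes "(f has_field_derivative f z * r) (at z)" "norm (f z) < 1" "f z \<noteq> 0"
  shows "((\<lambda>z. polylog 2 (f z)) has_field_derivative - ln (1 - f z) * r) (at z)"
  using DERIV_chain2[OF polylog2_deriv[OF assms(2,3)] assms(1)] assms(3) by simp

lemma polylog3_chain:
  assumes "(f has_field_derivative f z * r) (at z)" "norm (f z) < 1" "f z \<noteq> 0"
  shows "((\<lambda>z. polylog 3 (f z)) has_field_derivative polylog 2 (f z) * r) (at z)"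
  using DERIV_chain2[OF polylog3_deriv[OF assms(2,3)] assms(1)] assms(3) by simp

lemma log_deriv_one_minus:
  assumes "z \<noteq> 1"
  shows "((\<lambda>z. 1 - z) has_field_derivative (1 - z) * - inverse (1 - z)) (at (z::complex))"
  using assms by (auto intro!: derivative_eq_intros)

lemma log_deriv_inverse_one_plus:
  assumes "z \<noteq> -1"
  shows "((\<lambda>z. inverse (1 + z)) has_field_derivative inverse (1 + z) * - inverse (1 + z)) (at (z::complex))"
proof -
  have "1 + z \<noteq> 0" using assms by (metis add.commute add_eq_0_iff)
  thus ?thesis by (auto intro!: derivative_eq_intros)
qed

lemma log_deriv_Landen:
  assumes "z \<noteq> 0" "z \<noteq> 1"
  shows "((\<lambda>z. z / (z - 1)) has_field_derivative
            z / (z - 1) * (inverse z + inverse (1 - z))) (at (z::complex))"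
proof -
  have "((\<lambda>z. z / (z - 1)) has_field_derivative - 1 / (z - 1)\<^sup>2) (at z)"
    using assms by (auto intro!: derivative_eq_intros simp: power2_eq_square)
  moreover have "- 1 / (z - 1)\<^sup>2 = z / (z - 1) * (inverse z + inverse (1 - z))"
    using assms by (simp add: divide_simps power2_eq_square)
  ultimately show ?thesis by simp
qed

lemma Ln_deriv_of_real:
  "0 < x \<Longrightarrow> (ln has_field_derivative inverse (complex_of_real x)) (at (of_real x))"
  by (rule has_field_derivative_Ln) (auto simp: complex_nonpos_Reals_iff)

lemma Ln_one_minus_deriv_of_real:
  "x < 1 \<Longrightarrow> ((\<lambda>z. ln (1 - z)) has_field_derivative - inverse (1 - complex_of_real x)) (at (of_real x))"
  by (rule Ln_one_minus_deriv) (auto simp: complex_nonpos_Reals_iff)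

lemma Ln_one_plus_deriv_of_real:
  "-1 < x \<Longrightarrow> ((\<lambda>z. ln (1 + z)) has_field_derivative inverse (1 + complex_of_real x)) (at (of_real x))"
  by (rule Ln_one_plus_deriv) (auto simp: complex_nonpos_Reals_iff)

lemma norm_one_minus_of_real: "norm (1 - complex_of_real x) = \<bar>1 - x\<bar>"
  by (metis norm_of_real of_real_1 of_real_diff)

lemma norm_inverse_one_plus_of_real_le_1:
  assumes "0 < x"
  shows "norm (inverse (1 + complex_of_real x)) \<le> 1"
proof -
  have "norm (1 + complex_of_real x) = 1 + x"
    using assms by (metis abs_of_pos add_pos_pos norm_of_real of_real_1 of_real_add zero_less_one)
  thus ?thesis using assms by (simp add: norm_inverse inverse_le_1_iff)
qed

lemma tendsto_complex_of_real_right: "(complex_of_real \<longlongrightarrow> of_real c) (at_right c)"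
  by (intro tendsto_intros)

lemma tendsto_complex_of_real_left: "(complex_of_real \<longlongrightarrow> of_real c) (at_left c)"
  by (intro tendsto_intros)

lemma polylog_one_minus_deriv_of_real:
  assumes "0 < x" "x < 1"
  defines "z \<equiv> complex_of_real x"
  shows "((\<lambda>z. polylog 2 (1 - z)) has_field_derivative ln z * inverse (1 - z)) (at z)"
    and "((\<lambda>z. polylog 3 (1 - z)) has_field_derivative - polylog 2 (1 - z) * inverse (1 - z)) (at z)"
proof -
  have z: "z \<noteq> 1" "norm (1 - z) < 1" "1 - z \<noteq> 0"
    using assms by (auto simp: norm_one_minus_of_real)
  show "((\<lambda>z. polylog 2 (1 - z)) has_field_derivative ln z * inverse (1 - z)) (at z)"
    using polylog2_chain[of "\<lambda>z. 1 - z", OF log_deriv_one_minus[OF z(1)] z(2,3)] by simp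
  show "((\<lambda>z. polylog 3 (1 - z)) has_field_derivative - polylog 2 (1 - z) * inverse (1 - z)) (at z)"
    using polylog3_chain[of "\<lambda>z. 1 - z", OF log_deriv_one_minus[OF z(1)] z(2,3)] by simp
qed

lemma polylog_deriv_of_real:
  assumes "0 < x" "x < 1"
  defines "z \<equiv> complex_of_real x"
  shows "(polylog 2 has_field_derivative - ln (1 - z) * inverse z) (at z)"
    and "(polylog 3 has_field_derivative polylog 2 z * inverse z) (at z)"
  using polylog2_deriv[of z] polylog3_deriv[of z] assms by (simp_all add: divide_inverse)

text \<open>
  Euler's reflection formula. The constant is found at \<open>0\<close>, where the product of the logarithms tends to
  \<open>0\<close> and only \<open>Li\<^sub>2(1)\<close> remains.
\<close>

lemma polylog2_reflection:
  assumes "0 < x" "x < 1"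
  shows "polylog 2 (of_real x) + polylog 2 (1 - of_real x) + ln (of_real x) * ln (1 - of_real x)
           = of_real pi ^ 2 / 6"
proof (rule constant_on_interval[where a = 0 and b = 1])
  fix x :: real assume x: "0 < x" "x < 1"
  define z where "z = complex_of_real x"
  show "((\<lambda>z. polylog 2 z + polylog 2 (1 - z) + ln z * ln (1 - z)) has_field_derivative 0) (at z)"
  proof (rule DERIV_cong)
    show "((\<lambda>z. polylog 2 z + polylog 2 (1 - z) + ln z * ln (1 - z)) has_field_derivative
        (- ln (1 - z) * inverse z + ln z * inverse (1 - z)
          + (inverse z * ln (1 - z) + - inverse (1 - z) * ln z))) (at z)"
      unfolding z_def
      by (intro DERIV_add DERIV_mult polylog_deriv_of_real polylog_one_minus_deriv_of_real
            Ln_deriv_of_real Ln_one_minus_deriv_of_real x)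
  qed (simp add: mult.commute)
next
  have "((\<lambda>x. ln (complex_of_real x) * ln (1 - of_real x)) \<longlongrightarrow> of_real 0) (at_right 0)"
  proof (rule tendsto_complex_of_real_transform[where r = "\<lambda>x. ln x * ln (1 - x)"])
    show "((\<lambda>x::real. ln x * ln (1 - x)) \<longlongrightarrow> 0) (at_right 0)" by real_asymp
    show "\<forall>\<^sub>F x in at_right 0. ln (complex_of_real x) * ln (1 - of_real x) = of_real (ln x * ln (1 - x))"
      by (rule eventually_at_right_0I) (simp add: Ln_of_real Ln_one_minus_of_real)
  qed
  moreover have "((\<lambda>x. polylog 2 (complex_of_real x)) \<longlongrightarrow> polylog 2 (of_real 0)) (at_right 0)"
    by (intro polylog_tendsto tendsto_complex_of_real_right eventually_at_right_0I) auto
  moreover have "((\<lambda>x. polylog 2 (1 - complex_of_real x)) \<longlongrightarrow> polylog 2 (1 - of_real 0)) (at_right 0)"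
    by (intro polylog_tendsto tendsto_diff tendsto_const tendsto_complex_of_real_right
          eventually_at_right_0I) (auto simp: norm_one_minus_of_real)
  ultimately have "((\<lambda>x. polylog 2 (complex_of_real x) + polylog 2 (1 - of_real x)
        + ln (of_real x) * ln (1 - of_real x))
          \<longlongrightarrow> polylog 2 (of_real 0) + polylog 2 (1 - of_real 0) + of_real 0) (at_right 0)"
    by (intro tendsto_add)
  thus "((\<lambda>x. polylog 2 (complex_of_real x) + polylog 2 (1 - of_real x)
        + ln (of_real x) * ln (1 - of_real x)) \<longlongrightarrow> of_real pi ^ 2 / 6) (at_right 0)"
    by (simp add: polylog2_1)
qed (use assms in auto)

text \<open>
  Landen's substitution \<open>z / (z - 1)\<close> stays in the unit disk exactly for \<open>x < 1/2\<close>, and it changes the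
  sign of \<open>log (1 - z)\<close>.
\<close>

lemma Landen_argument:
  assumes "0 < x" "x < 1 / 2"
  defines "z \<equiv> complex_of_real x"
  shows "norm (z / (z - 1)) < 1" "z / (z - 1) \<noteq> 0" "z \<noteq> 0" "z \<noteq> 1"
    and "ln (1 - z / (z - 1)) = - ln (1 - z)"
proof -
  show z: "z \<noteq> 0" "z \<noteq> 1" using assms by auto
  have w: "z / (z - 1) = of_real (- (x / (1 - x)))"
    using assms(1,2) by (simp add: z_def divide_simps) (simp add: algebra_simps)
  show "norm (z / (z - 1)) < 1"
    unfolding w norm_of_real using assms by (simp add: abs_if divide_less_eq)
  show "z / (z - 1) \<noteq> 0" using z by simp
  have "1 - z / (z - 1) = of_real (1 / (1 - x))"
    unfolding w using assms(1,2) by (simp add: divide_simps)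
  also have "ln \<dots> = of_real (ln (1 / (1 - x)))"
    using assms by (intro Ln_of_real) auto
  also have "ln (1 / (1 - x)) = - ln (1 - x)"
    using assms by (simp add: ln_div)
  finally show "ln (1 - z / (z - 1)) = - ln (1 - z)"
    using assms by (simp add: Ln_one_minus_of_real)
qed

lemma tendsto_Landen_argument:
  "((\<lambda>x. complex_of_real x / (of_real x - 1)) \<longlongrightarrow> 0) (at_right 0)"
proof -
  have "((\<lambda>x. complex_of_real x / (of_real x - 1)) \<longlongrightarrow> of_real 0 / (of_real 0 - 1)) (at_right 0)"
    by (intro tendsto_intros) auto
  thus ?thesis by simp
qed

lemma polylog2_Landen:
  assumes "0 < x" "x < 1 / 2"
  shows "polylog 2 (of_real x) + polylog 2 (of_real x / (of_real x - 1))
           + (ln (1 - of_real x))\<^sup>2 * (1 / 2) = 0"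
proof (rule constant_on_interval[where a = 0 and b = "1 / 2"])
  fix x :: real assume x: "0 < x" "x < 1 / 2"
  define z where "z = complex_of_real x"
  note w = Landen_argument[OF x, folded z_def]
  have x': "x < 1" using x by simp
  have dL: "((\<lambda>z. ln (1 - z)) has_field_derivative - inverse (1 - z)) (at z)"
    unfolding z_def by (rule Ln_one_minus_deriv_of_real[OF x'])
  have dW: "((\<lambda>z. polylog 2 (z / (z - 1))) has_field_derivative
              ln (1 - z) * (inverse z + inverse (1 - z))) (at z)"
    using polylog2_chain[of "\<lambda>z. z / (z - 1)", OF log_deriv_Landen[OF w(3,4)] w(1,2)] w(5) by simp
  have d2: "((\<lambda>z. polylog 2 z) has_field_derivative - ln (1 - z) * inverse z) (at z)"
    unfolding z_def by (rule polylog_deriv_of_real(1)[OF x(1) x'])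
  show "((\<lambda>z. polylog 2 z + polylog 2 (z / (z - 1)) + (ln (1 - z))\<^sup>2 * (1 / 2))
           has_field_derivative 0) (at z)"
    by (rule DERIV_cong[OF DERIV_add[OF DERIV_add[OF d2 dW] DERIV_cmult_right[OF DERIV_power[OF dL]]]])
       (simp add: algebra_simps)
next
  have "((\<lambda>x. ln (1 - complex_of_real x)) \<longlongrightarrow> ln (1 - of_real 0)) (at_right 0)"
    by (intro tendsto_Ln tendsto_intros) auto
  hence "((\<lambda>x. polylog 2 (complex_of_real x) + polylog 2 (of_real x / (of_real x - 1))
        + (ln (1 - of_real x))\<^sup>2 * (1 / 2))
          \<longlongrightarrow> polylog 2 (of_real 0) + polylog 2 0 + (ln (1 - of_real 0))\<^sup>2 * (1 / 2)) (at_right 0)"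
    by (intro tendsto_add tendsto_mult tendsto_power tendsto_const polylog_tendsto
          tendsto_complex_of_real_right tendsto_Landen_argument
          eventually_at_rightI[of 0 "1 / 2"] Landen_argument(1)[THEN less_imp_le]) auto
  thus "((\<lambda>x. polylog 2 (complex_of_real x) + polylog 2 (of_real x / (of_real x - 1))
        + (ln (1 - of_real x))\<^sup>2 * (1 / 2)) \<longlongrightarrow> 0) (at_right 0)"
    by simp
qed (use assms in auto)

text \<open>
  Landen's identity relates \<open>Li\<^sub>3\<close> at \<open>x\<close>, \<open>1 - x\<close> and \<open>x / (x - 1)\<close> to logarithms. Its derivative is a
  combination of the reflection formula (terms with \<open>1 / (1 - x)\<close>) and of Landen's identity for \<open>Li\<^sub>2\<close>
  (both denominators). The constant is \<open>Li\<^sub>3(1)\<close>, from \<open>x \<rightarrow> 0\<close>; at \<open>x = 1/2\<close> the three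
  arguments are \<open>1/2\<close>, \<open>1/2\<close> and \<open>-1\<close>, and \<open>Li\<^sub>3(-1)\<close> is a multiple of \<open>Li\<^sub>3(1)\<close>.
\<close>

lemma polylog3_half:
  "polylog 3 (1 / 2) = 7 / 8 * zeta 3 - of_real pi ^ 2 / 12 * ln 2 + (ln 2) ^ 3 / 6"
proof -
  define c :: complex where "c = of_real pi ^ 2 / 6"
  define F where "F = (\<lambda>z. polylog 3 z + polylog 3 (1 - z) + polylog 3 (z / (z - 1))
      - (ln (1 - z)) ^ 3 * (1 / 6) - c * ln (1 - z) + (ln (1 - z))\<^sup>2 * ln z * (1 / 2))"
  have "zeta 3 = F (1 / 2)"
  proof (rule limits_agree[where a = 0 and b = "1 / 2" and F = F])
    fix x :: real assume x: "0 < x" "x < 1 / 2"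
    define z where "z = complex_of_real x"
    note w = Landen_argument[OF x, folded z_def]
    have x': "x < 1" using x by simp
    define p where "p = inverse z"
    define u where "u = inverse (1 - z)"
    define L where "L = ln (1 - z)"
    have dl: "((\<lambda>z. ln z) has_field_derivative p) (at z)"
      unfolding z_def p_def by (rule Ln_deriv_of_real[OF x(1)])
    have dL: "((\<lambda>z. ln (1 - z)) has_field_derivative - u) (at z)"
      unfolding z_def u_def by (rule Ln_one_minus_deriv_of_real[OF x'])
    have dL2: "((\<lambda>z. (ln (1 - z))\<^sup>2) has_field_derivative - 2 * L * u) (at z)"
      using DERIV_power[OF dL, of 2] by (simp add: L_def mult_ac)
    have dL3: "((\<lambda>z. (ln (1 - z)) ^ 3) has_field_derivative - 3 * L\<^sup>2 * u) (at z)"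
      using DERIV_power[OF dL, of 3] by (simp add: L_def mult_ac)
    have d1: "((\<lambda>z. polylog 3 z) has_field_derivative polylog 2 z * p) (at z)"
      unfolding z_def p_def by (rule polylog_deriv_of_real(2)[OF x(1) x'])
    have d2: "((\<lambda>z. polylog 3 (1 - z)) has_field_derivative - polylog 2 (1 - z) * u) (at z)"
      unfolding z_def u_def by (rule polylog_one_minus_deriv_of_real(2)[OF x(1) x'])
    have d3: "((\<lambda>z. polylog 3 (z / (z - 1))) has_field_derivative
                polylog 2 (z / (z - 1)) * (p + u)) (at z)"
      unfolding p_def u_def
      using polylog3_chain[of "\<lambda>z. z / (z - 1)", OF log_deriv_Landen[OF w(3,4)] w(1,2)] .
    have refl: "polylog 2 (1 - z) = c - polylog 2 z - ln z * L"
    proof -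
      have sum: "polylog 2 z + polylog 2 (1 - z) + ln z * L = c"
        using polylog2_reflection[OF x(1) x'] unfolding c_def L_def z_def .
      show ?thesis unfolding sum[symmetric] by simp
    qed
    have Landen: "polylog 2 (z / (z - 1)) = - polylog 2 z - L\<^sup>2 * (1 / 2)"
    proof -
      have "polylog 2 z + polylog 2 (z / (z - 1)) + L\<^sup>2 * (1 / 2) = 0"
        using polylog2_Landen[OF x] unfolding L_def z_def .
      moreover have "b = - a - m" if "a + b + m = 0" for a b m :: complex
        using that by (simp add: algebra_simps add_eq_0_iff)
      ultimately show ?thesis by blast
    qed
    show "(F has_field_derivative 0) (at z)"
      unfolding F_def
    proof (rule DERIV_cong)
      show "((\<lambda>z. polylog 3 z + polylog 3 (1 - z) + polylog 3 (z / (z - 1))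
          - (ln (1 - z)) ^ 3 * (1 / 6) - c * ln (1 - z) + (ln (1 - z))\<^sup>2 * ln z * (1 / 2))
          has_field_derivative
          (polylog 2 z * p + - polylog 2 (1 - z) * u + polylog 2 (z / (z - 1)) * (p + u)
           - - 3 * L\<^sup>2 * u * (1 / 6) - c * - u
           + (- 2 * L * u * ln z + p * (ln (1 - z))\<^sup>2) * (1 / 2))) (at z)"
        by (intro DERIV_add DERIV_diff DERIV_cmult DERIV_cmult_right DERIV_mult d1 d2 d3 dL3 dL dL2 dl)
    qed (simp add: refl Landen L_def[symmetric] algebra_simps power2_eq_square)
  next
    have ln1: "((\<lambda>x. ln (1 - complex_of_real x)) \<longlongrightarrow> ln (1 - of_real 0)) (at_right 0)"
      by (intro tendsto_Ln tendsto_intros) auto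
    have ln2: "((\<lambda>x. (ln (1 - complex_of_real x))\<^sup>2 * ln (of_real x)) \<longlongrightarrow> of_real 0) (at_right 0)"
    proof (rule tendsto_complex_of_real_transform[where r = "\<lambda>x. (ln (1 - x))\<^sup>2 * ln x"])
      show "((\<lambda>x::real. (ln (1 - x))\<^sup>2 * ln x) \<longlongrightarrow> 0) (at_right 0)" by real_asymp
      show "\<forall>\<^sub>F x in at_right 0. (ln (1 - complex_of_real x))\<^sup>2 * ln (of_real x) = of_real ((ln (1 - x))\<^sup>2 * ln x)"
        by (rule eventually_at_right_0I) (simp add: Ln_of_real Ln_one_minus_of_real)
    qed
    have "((\<lambda>x. F (of_real x)) \<longlongrightarrow> polylog 3 (of_real 0) + polylog 3 (1 - of_real 0) + polylog 3 0
         - (ln (1 - of_real 0)) ^ 3 * (1 / 6) - c * ln (1 - of_real 0) + of_real 0 * (1 / 2)) (at_right 0)"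
      unfolding F_def
      by (intro tendsto_add tendsto_diff tendsto_mult[OF ln2] tendsto_mult tendsto_power tendsto_const
          polylog_tendsto tendsto_complex_of_real_right tendsto_Landen_argument ln1
          eventually_at_rightI[of 0 "1 / 2"] Landen_argument(1)[THEN less_imp_le])
         (auto simp: norm_one_minus_of_real)
    thus "((\<lambda>x. F (of_real x)) \<longlongrightarrow> zeta 3) (at_right 0)"
      by (simp add: polylog3_1)
  next
    have id: "((\<lambda>x. complex_of_real x) \<longlongrightarrow> 1 / 2) (at_left (1 / 2))"
      using tendsto_complex_of_real_left[of "1 / 2"] by simp
    have "((\<lambda>x. complex_of_real x / (of_real x - 1)) \<longlongrightarrow> (1 / 2) / (1 / 2 - 1)) (at_left (1 / 2))"
      by (intro tendsto_intros id) auto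
    moreover have "((\<lambda>x. ln (1 - complex_of_real x)) \<longlongrightarrow> ln (1 - 1 / 2)) (at_left (1 / 2))"
      by (intro tendsto_Ln tendsto_intros id) (auto simp: complex_nonpos_Reals_iff)
    moreover have "((\<lambda>x. ln (complex_of_real x)) \<longlongrightarrow> ln (1 / 2)) (at_left (1 / 2))"
      by (intro tendsto_Ln id) (auto simp: complex_nonpos_Reals_iff)
    ultimately show "((\<lambda>x. F (of_real x)) \<longlongrightarrow> F (1 / 2)) (at_left (1 / 2))"
      unfolding F_def
      by (intro tendsto_add tendsto_diff tendsto_mult tendsto_power tendsto_const
          polylog_tendsto id eventually_at_leftI[of 0 "1 / 2"] Landen_argument(1)[THEN less_imp_le])
         (auto simp: norm_one_minus_of_real)
  qed simp
  moreover have "ln (1 / 2) = - (ln 2 :: complex)"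
    using Ln_half[of 1] by simp
  moreover have "polylog 3 (-1) = - 3 / 4 * zeta 3"
    using polylog_minus_1[of 3] by (simp add: polylog3_1)
  ultimately have "zeta 3 = 2 * polylog 3 (1 / 2) - 3 / 4 * zeta 3
      + (ln 2) ^ 3 / 6 + c * ln 2 - (ln 2) ^ 3 / 2"
    by (simp add: F_def power3_eq_cube power2_eq_square)
  hence double: "2 * polylog 3 (1 / 2)
      = zeta 3 + 3 / 4 * zeta 3 - c * ln 2 + ((ln 2) ^ 3 / 2 - (ln 2) ^ 3 / 6)"
    by (simp add: algebra_simps)
  have "polylog 3 (1 / 2) = 1 / 2 * (2 * polylog 3 (1 / 2))"
    by simp
  thus ?thesis
    unfolding double c_def by (simp add: algebra_simps)
qed


section \<open>The values of \<open>G\<close> at \<open>1\<close> and \<open>-1\<close>\<close>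

text \<open>
  The difference \<open>G - G_explicit\<close> is the integral of \<open>Li\<^sub>2(t) / (1 - t)\<close>; adding the boundary term
  \<open>log (1 - z) Li\<^sub>2(z)\<close> of an integration by parts leaves the integral of \<open>- log\<^sup>2(1 - t) / t\<close>.
\<close>

definition log_square_primitive :: "complex \<Rightarrow> complex" where
  "log_square_primitive z = G z - G_explicit z + ln (1 - z) * polylog 2 z"

lemma log_square_primitive_deriv:
  assumes "norm z < 1" "z \<noteq> 0"
  shows "(log_square_primitive has_field_derivative - (ln (1 - z))\<^sup>2 * inverse z) (at z)"
proof -
  define u where "u = inverse (1 - z)"
  have z: "norm z \<le> 1" "z \<noteq> 1" "z \<noteq> -1"
    using assms unit_disk_not_pm1[of z] by auto
  have dL: "((\<lambda>z. ln (1 - z)) has_field_derivative - u) (at z)"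
    unfolding u_def by (rule Ln_one_minus_deriv[OF one_minus_notin_nonpos_Reals[OF z(1,2)]])
  have dLi: "(polylog 2 has_field_derivative - ln (1 - z) * inverse z) (at z)"
    using polylog2_deriv[OF assms] by (simp add: divide_inverse)
  have dR: "(G_explicit has_field_derivative g z - polylog 2 z * u) (at z)"
    using G_explicit_deriv[OF assms(1)] by (simp add: u_def divide_inverse)
  show ?thesis
    unfolding log_square_primitive_def
    by (rule DERIV_cong[OF DERIV_add[OF DERIV_diff[OF G_deriv[OF assms(1)] dR] DERIV_mult[OF dL dLi]]])
       (simp add: algebra_simps power2_eq_square)
qed

lemma log_square_primitive_tendsto_0: "(log_square_primitive \<longlongrightarrow> 0) (at 0)"
proof -
  have "(log_square_primitive has_field_derivative
          (g 0 - (g 0 - polylog 2 0 / (1 - 0)) + (- inverse (1 - 0) * polylog 2 0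
            + powser (diffs (polylog_coeff 2)) 0 * ln (1 - 0)))) (at 0)"
    unfolding log_square_primitive_def
    by (intro DERIV_add DERIV_diff DERIV_mult G_deriv G_explicit_deriv polylog_deriv_powser
          Ln_one_minus_deriv) auto
  hence "isCont log_square_primitive 0" by (rule DERIV_isCont)
  thus ?thesis by (simp add: isCont_def log_square_primitive_def G_0 G_explicit_0)
qed

lemma log_square_primitive_compose_tendsto_0:
  assumes "(f \<longlongrightarrow> (0::complex)) F" "\<forall>\<^sub>F x in F. f x \<noteq> 0"
  shows "((\<lambda>x. log_square_primitive (f x)) \<longlongrightarrow> 0) F"
  using filterlim_compose[OF log_square_primitive_tendsto_0, of f F] assms by (simp add: filterlim_at)

lemma tendsto_ln_one_minus_times_polylog2:
  fixes w :: "real \<Rightarrow> real"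
  assumes "((\<lambda>x. ln (1 - x) * w x) \<longlongrightarrow> 0) F"
    and "\<forall>\<^sub>F x in F. x < 1 \<and> \<bar>w x\<bar> \<le> 1"
  shows "((\<lambda>x. ln (1 - complex_of_real x) * polylog 2 (of_real (w x))) \<longlongrightarrow> 0) F"
proof (rule tendsto_times_polylog2_0)
  have "\<forall>\<^sub>F x in F. ln (1 - complex_of_real x) * of_real (w x) = of_real (ln (1 - x) * w x)"
    using assms(2) by eventually_elim (simp add: Ln_one_minus_of_real)
  from tendsto_complex_of_real_transform[OF assms(1) this]
  show "((\<lambda>x. ln (1 - complex_of_real x) * of_real (w x)) \<longlongrightarrow> 0) F" by simp
  show "\<forall>\<^sub>F x in F. norm (complex_of_real (w x)) \<le> 1"
    using assms(2) by eventually_elim simp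
qed

text \<open>
  The reflection formula replaces \<open>Li\<^sub>2(w) - \<pi>\<^sup>2/6\<close>, for \<open>w\<close> near \<open>1\<close>, by \<open>Li\<^sub>2(1 - w)\<close> and a product of
  logarithms. Then the preceding lemma applies.
\<close>

lemma tendsto_ln_one_minus_times_polylog2_defect:
  fixes w :: "real \<Rightarrow> real"
  assumes "((\<lambda>x. ln (1 - x) * (1 - w x)) \<longlongrightarrow> 0) F"
    and "((\<lambda>x. ln (1 - x) * (ln (w x) * ln (1 - w x))) \<longlongrightarrow> 0) F"
    and "\<forall>\<^sub>F x in F. x < 1 \<and> 0 < w x \<and> w x < 1"
  shows "((\<lambda>x. ln (1 - complex_of_real x) * (polylog 2 (of_real (w x)) - of_real pi ^ 2 / 6)) \<longlongrightarrow> 0) F"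
proof -
  have ev: "\<forall>\<^sub>F x in F. x < 1 \<and> \<bar>1 - w x\<bar> \<le> 1"
    using assms(3) by eventually_elim auto
  have 1: "((\<lambda>x. ln (1 - complex_of_real x) * polylog 2 (of_real (1 - w x))) \<longlongrightarrow> 0) F"
    by (rule tendsto_ln_one_minus_times_polylog2[OF assms(1) ev])
  have 2: "((\<lambda>x. complex_of_real (ln (1 - x) * (ln (w x) * ln (1 - w x)))) \<longlongrightarrow> of_real 0) F"
    by (rule tendsto_of_real[OF assms(2)])
  have "((\<lambda>x. - (ln (1 - complex_of_real x) * polylog 2 (of_real (1 - w x)))
           - complex_of_real (ln (1 - x) * (ln (w x) * ln (1 - w x)))) \<longlongrightarrow> 0) F"
    using tendsto_diff[OF tendsto_minus[OF 1] 2] by simp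
  moreover have "\<forall>\<^sub>F x in F. - (ln (1 - complex_of_real x) * polylog 2 (of_real (1 - w x)))
           - complex_of_real (ln (1 - x) * (ln (w x) * ln (1 - w x)))
         = ln (1 - complex_of_real x) * (polylog 2 (of_real (w x)) - of_real pi ^ 2 / 6)"
    using assms(3)
  proof eventually_elim
    case (elim x)
    have step: "polylog 2 (of_real (w x)) - of_real pi ^ 2 / 6
        = - polylog 2 (1 - of_real (w x)) - ln (of_real (w x)) * ln (1 - of_real (w x))"
      using polylog2_reflection[of "w x"] elim by (simp add: algebra_simps)
    show ?case
      unfolding step
      using elim by (simp add: Ln_one_minus_of_real Ln_of_real algebra_simps)
  qed
  ultimately show ?thesis by (rule Lim_transform_eventually)
qed

text \<open>
  On \<open>(0, 1)\<close>, the function \<open>- log\<^sup>2(1 - x) log x - 2 log (1 - x) Li\<^sub>2(1 - x) + 2 Li\<^sub>3(1 - x)\<close> is another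
  primitive of \<open>- log\<^sup>2(1 - x) / x\<close>. At \<open>0\<close> the difference of the two primitives is \<open>-2 Li\<^sub>3(1)\<close>. At
  \<open>1\<close> the unbounded logarithm \<open>log (1 - x)\<close> occurs only in groups of terms that vanish in the limit.
\<close>

lemma G_1: "G 1 = 3 / 2 * zeta 3 - of_real pi ^ 2 / 6 * ln 2 - 1 / 3 * (ln 2) ^ 3"
proof -
  define c :: complex where "c = of_real pi ^ 2 / 6"
  define h :: complex where "h = ln 2"
  define F where "F = (\<lambda>z. log_square_primitive z + (ln (1 - z))\<^sup>2 * ln z + 2 * (ln (1 - z) * polylog 2 (1 - z))
      - 2 * polylog 3 (1 - z))"
  have "- 2 * zeta 3 = G 1 - (2 * h * (c - polylog 2 (1 / 2)) - 2 * h ^ 3 + 4 * polylog 3 (1 / 2))"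
  proof (rule limits_agree[where a = 0 and b = 1 and F = F])
    fix x :: real assume x: "0 < x" "x < 1"
    define z where "z = complex_of_real x"
    have z: "norm z < 1" "z \<noteq> 0" using x by (auto simp: z_def)
    define p where "p = inverse z"
    define u where "u = inverse (1 - z)"
    define L where "L = ln (1 - z)"
    have dl: "((\<lambda>z. ln z) has_field_derivative p) (at z)"
      unfolding z_def p_def by (rule Ln_deriv_of_real[OF x(1)])
    have dL: "((\<lambda>z. ln (1 - z)) has_field_derivative - u) (at z)"
      unfolding z_def u_def by (rule Ln_one_minus_deriv_of_real[OF x(2)])
    have dL2: "((\<lambda>z. (ln (1 - z))\<^sup>2) has_field_derivative - 2 * L * u) (at z)"
      using DERIV_power[OF dL, of 2] by (simp add: L_def mult_ac)
    have d1: "((\<lambda>z. polylog 2 (1 - z)) has_field_derivative ln z * u) (at z)"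
      unfolding z_def u_def by (rule polylog_one_minus_deriv_of_real(1)[OF x])
    have d2: "((\<lambda>z. polylog 3 (1 - z)) has_field_derivative - polylog 2 (1 - z) * u) (at z)"
      unfolding z_def u_def by (rule polylog_one_minus_deriv_of_real(2)[OF x])
    have dM: "(log_square_primitive has_field_derivative - L\<^sup>2 * p) (at z)"
      unfolding L_def p_def by (rule log_square_primitive_deriv[OF z])
    show "(F has_field_derivative 0) (at z)"
      unfolding F_def
    proof (rule DERIV_cong)
      show "((\<lambda>z. log_square_primitive z + (ln (1 - z))\<^sup>2 * ln z + 2 * (ln (1 - z) * polylog 2 (1 - z))
            - 2 * polylog 3 (1 - z)) has_field_derivative
          (- L\<^sup>2 * p + (- 2 * L * u * ln z + p * (ln (1 - z))\<^sup>2)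
            + 2 * (- u * polylog 2 (1 - z) + ln z * u * ln (1 - z))
            - 2 * (- polylog 2 (1 - z) * u))) (at z)"
        by (intro DERIV_add DERIV_diff DERIV_cmult DERIV_mult dM d1 d2 dL2 dL dl)
    qed (simp add: L_def[symmetric] algebra_simps power2_eq_square)
  next
    have M: "((\<lambda>x. log_square_primitive (complex_of_real x)) \<longlongrightarrow> 0) (at_right 0)"
      using tendsto_complex_of_real_right[of 0]
      by (intro log_square_primitive_compose_tendsto_0 eventually_at_right_0I) auto
    have ln1: "((\<lambda>x. ln (1 - complex_of_real x)) \<longlongrightarrow> ln (1 - of_real 0)) (at_right 0)"
      by (intro tendsto_Ln tendsto_intros) auto
    have ln2: "((\<lambda>x. (ln (1 - complex_of_real x))\<^sup>2 * ln (of_real x)) \<longlongrightarrow> of_real 0) (at_right 0)"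
    proof (rule tendsto_complex_of_real_transform[where r = "\<lambda>x. (ln (1 - x))\<^sup>2 * ln x"])
      show "((\<lambda>x::real. (ln (1 - x))\<^sup>2 * ln x) \<longlongrightarrow> 0) (at_right 0)" by real_asymp
      show "\<forall>\<^sub>F x in at_right 0. (ln (1 - complex_of_real x))\<^sup>2 * ln (of_real x) = of_real ((ln (1 - x))\<^sup>2 * ln x)"
        by (rule eventually_at_right_0I) (simp add: Ln_of_real Ln_one_minus_of_real)
    qed
    have "((\<lambda>x. F (of_real x)) \<longlongrightarrow> 0 + of_real 0 + 2 * (ln (1 - of_real 0) * polylog 2 (1 - of_real 0))
            - 2 * polylog 3 (1 - of_real 0)) (at_right 0)"
      unfolding F_def
      by (intro tendsto_add tendsto_diff M ln2 tendsto_mult tendsto_const ln1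
          polylog_tendsto tendsto_complex_of_real_right eventually_at_right_0I)
         (auto simp: norm_one_minus_of_real)
    thus "((\<lambda>x. F (of_real x)) \<longlongrightarrow> - 2 * zeta 3) (at_right 0)"
      by (simp add: polylog3_1)
  next
    define L where "L = (\<lambda>x. ln (1 - complex_of_real x))"
    define P where "P = (\<lambda>x. ln (1 + complex_of_real x))"
    define A where "A = (\<lambda>x. polylog 2 ((1 + complex_of_real x) / 2))"
    have id: "((\<lambda>x. complex_of_real x) \<longlongrightarrow> 1) (at_left 1)"
      using tendsto_complex_of_real_left[of 1] by simp
    have G: "((\<lambda>x. G (complex_of_real x)) \<longlongrightarrow> G 1) (at_left 1)"
      by (rule continuous_on_tendsto_compose[OF G_continuous id])
         (auto intro!: eventually_at_left_1I)
    have P: "(P \<longlongrightarrow> h) (at_left 1)"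
      unfolding P_def h_def using tendsto_Ln[OF tendsto_add[OF tendsto_const id, of 1]]
      by (simp add: complex_nonpos_Reals_iff)
    have T: "((\<lambda>x. polylog 3 ((1 - complex_of_real x) / 2)) \<longlongrightarrow> polylog 3 ((1 - 1) / 2)) (at_left 1)"
      by (intro polylog_tendsto tendsto_divide tendsto_diff tendsto_const id eventually_at_left_1I)
         (auto simp: norm_divide norm_one_minus_of_real)
    have A: "(A \<longlongrightarrow> c) (at_left 1)"
    proof -
      have "(A \<longlongrightarrow> polylog 2 ((1 + 1) / 2)) (at_left 1)"
        unfolding A_def
        using half_1_plus_mem
        by (intro polylog_tendsto tendsto_divide tendsto_add tendsto_const id eventually_at_left_1I) auto
      thus ?thesis by (simp add: polylog2_1 c_def)
    qed
    have T': "((\<lambda>x. polylog 3 (1 - complex_of_real x)) \<longlongrightarrow> polylog 3 (1 - 1)) (at_left 1)"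
      by (intro polylog_tendsto tendsto_diff tendsto_const id eventually_at_left_1I)
         (auto simp: norm_one_minus_of_real)
    have LLi: "((\<lambda>x. L x * (polylog 2 (of_real x) - c)) \<longlongrightarrow> 0) (at_left 1)"
      unfolding L_def c_def
      by (rule tendsto_ln_one_minus_times_polylog2_defect; (rule eventually_at_left_1I, simp; fail)?; real_asymp)
    have LA: "((\<lambda>x. L x * (A x - c)) \<longlongrightarrow> 0) (at_left 1)"
    proof -
      have "((\<lambda>x. L x * (polylog 2 (of_real ((1 + x) / 2)) - c)) \<longlongrightarrow> 0) (at_left 1)"
        unfolding L_def c_def
        by (rule tendsto_ln_one_minus_times_polylog2_defect; (rule eventually_at_left_1I, simp; fail)?; real_asymp)
      thus ?thesis by (simp add: A_def)
    qed
    have LB: "((\<lambda>x. L x * polylog 2 ((1 - of_real x) / 2)) \<longlongrightarrow> 0) (at_left 1)"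
    proof -
      have "((\<lambda>x. L x * polylog 2 (of_real ((1 - x) / 2))) \<longlongrightarrow> 0) (at_left 1)"
        unfolding L_def
        by (rule tendsto_ln_one_minus_times_polylog2; (rule eventually_at_left_1I, simp; fail)?; real_asymp)
      thus ?thesis by simp
    qed
    have LB': "((\<lambda>x. L x * polylog 2 (1 - of_real x)) \<longlongrightarrow> 0) (at_left 1)"
    proof -
      have "((\<lambda>x. L x * polylog 2 (of_real (1 - x))) \<longlongrightarrow> 0) (at_left 1)"
        unfolding L_def
        by (rule tendsto_ln_one_minus_times_polylog2; (rule eventually_at_left_1I, simp; fail)?; real_asymp)
      thus ?thesis by simp
    qed
    have PL: "((\<lambda>x. (P x - h) * (L x)\<^sup>2) \<longlongrightarrow> of_real 0) (at_left 1)"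
    proof (rule tendsto_complex_of_real_transform[where r = "\<lambda>x. (ln (1 + x) - ln 2) * (ln (1 - x))\<^sup>2"])
      show "((\<lambda>x::real. (ln (1 + x) - ln 2) * (ln (1 - x))\<^sup>2) \<longlongrightarrow> 0) (at_left 1)" by real_asymp
      show "\<forall>\<^sub>F x in at_left 1. (P x - h) * (L x)\<^sup>2 = of_real ((ln (1 + x) - ln 2) * (ln (1 - x))\<^sup>2)"
        by (rule eventually_at_left_1I)
           (simp add: P_def L_def h_def Ln_one_plus_of_real Ln_one_minus_of_real complex_ln_2)
    qed
    have LLl: "((\<lambda>x. (L x)\<^sup>2 * ln (of_real x)) \<longlongrightarrow> of_real 0) (at_left 1)"
    proof (rule tendsto_complex_of_real_transform[where r = "\<lambda>x. (ln (1 - x))\<^sup>2 * ln x"])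
      show "((\<lambda>x::real. (ln (1 - x))\<^sup>2 * ln x) \<longlongrightarrow> 0) (at_left 1)" by real_asymp
      show "\<forall>\<^sub>F x in at_left 1. (L x)\<^sup>2 * ln (of_real x) = of_real ((ln (1 - x))\<^sup>2 * ln x)"
        by (rule eventually_at_left_1I) (simp add: L_def Ln_of_real Ln_one_minus_of_real)
    qed
    \<comment> \<open>Grouping: every power of \<open>L\<close> is multiplied by a factor that vanishes at \<open>1\<close>, namely \<open>Li\<^sub>2(x) - c\<close>, \<open>A - c\<close>, \<open>P - h\<close>, \<open>log x\<close> or a dilogarithm of a small argument.\<close>
    have F_eq: "F (of_real x) = G (of_real x) + L x * (polylog 2 (of_real x) - c) - 2 * (L x * (A x - c))
        - 2 * ((P x - h) * (L x)\<^sup>2) + 2 * P x * h\<^sup>2 - 2 * h * (A x - polylog 2 (1 / 2))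
        - 4 * (L x * polylog 2 ((1 - of_real x) / 2))
        + 4 * (polylog 3 ((1 - of_real x) / 2) - polylog 3 (1 / 2))
        + (L x)\<^sup>2 * ln (of_real x) + 2 * (L x * polylog 2 (1 - of_real x))
        - 2 * polylog 3 (1 - of_real x)" for x
    proof -
      have atoms: "ln (1 - complex_of_real x) = L x" "ln (1 + complex_of_real x) = P x"
        "polylog 2 ((1 + complex_of_real x) / 2) = A x" "ln 2 = h" "of_real pi ^ 2 / 6 = c"
        by (simp_all add: L_def P_def A_def h_def c_def)
      show ?thesis
        unfolding F_def log_square_primitive_def G_explicit_def atoms by (simp add: algebra_simps)
    qed
    have "((\<lambda>x. F (of_real x)) \<longlongrightarrow> G 1 + 0 - 2 * 0
        - 2 * of_real 0 + 2 * h * h\<^sup>2 - 2 * h * (c - polylog 2 (1 / 2))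
        - 4 * 0 + 4 * (polylog 3 ((1 - 1) / 2) - polylog 3 (1 / 2))
        + of_real 0 + 2 * 0 - 2 * polylog 3 (1 - 1)) (at_left 1)"
      unfolding F_eq
      by (intro tendsto_add tendsto_diff tendsto_mult[OF tendsto_const LA] tendsto_mult[OF tendsto_const LB]
           tendsto_mult[OF tendsto_const LB'] tendsto_mult[OF tendsto_const PL]
           LLi LLl tendsto_mult tendsto_const G P A T T')
    thus "((\<lambda>x. F (of_real x)) \<longlongrightarrow>
        G 1 - (2 * h * (c - polylog 2 (1 / 2)) - 2 * h ^ 3 + 4 * polylog 3 (1 / 2))) (at_left 1)"
      by (simp add: algebra_simps power3_eq_cube power2_eq_square)
  qed simp
  hence "G 1 = - 2 * zeta 3 + 2 * h * (c - polylog 2 (1 / 2)) - 2 * h ^ 3 + 2 * (2 * polylog 3 (1 / 2))"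
    by (simp add: algebra_simps)
  thus ?thesis
    unfolding polylog3_half polylog2_half h_def c_def
    by (simp add: algebra_simps power3_eq_cube power2_eq_square)
qed


text \<open>
  With \<open>z = -x\<close> the primitive to be evaluated has derivative \<open>- log\<^sup>2(1 + x) / x\<close> in \<open>x\<close>. On \<open>(0, 1)\<close> the
  polylogarithms at \<open>1 / (1 + x)\<close> provide a second one. The difference is \<open>-2 Li\<^sub>3(1)\<close> at \<open>0\<close>, and at
  \<open>1\<close> the polylogarithms are taken at \<open>1/2\<close>.
\<close>

lemma G_minus_1: "G (-1) = of_real pi ^ 2 / 12 * ln 2 - 3 / 4 * zeta 3 - 1 / 3 * (ln 2) ^ 3"
proof -
  define c :: complex where "c = of_real pi ^ 2 / 6"
  define h :: complex where "h = ln 2"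
  define F where "F = (\<lambda>z. log_square_primitive (- z) + (ln (1 + z))\<^sup>2 * ln z - 2 / 3 * ln (1 + z) ^ 3
      - 2 * (ln (1 + z) * polylog 2 (inverse (1 + z))) - 2 * polylog 3 (inverse (1 + z)))"
  have "- 2 * zeta 3 = G (-1) - (- h * c - 2 * h * polylog 2 (1 / 2) - 2 * h ^ 3 + 4 * h * c
      - 4 * (zeta 3 - polylog 3 (1 / 2))) + h * polylog 2 (-1)
      - 2 / 3 * h ^ 3 - 2 * (h * polylog 2 (1 / 2)) - 2 * polylog 3 (1 / 2)"
  proof (rule limits_agree[where a = 0 and b = 1 and F = F])
    fix x :: real assume x: "0 < x" "x < 1"
    define z where "z = complex_of_real x"
    have z: "norm (- z) < 1" "- z \<noteq> 0" "z \<noteq> -1" "1 + z \<noteq> 0"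
      using x unit_disk_not_pm1[of z] by (auto simp: z_def add_eq_0_iff)
    define p where "p = inverse z"
    define v where "v = inverse (1 + z)"
    define U where "U = ln (1 + z)"
    have w: "inverse (1 + z) = of_real (1 / (1 + x))"
      by (simp add: z_def inverse_eq_divide)
    have nw: "norm (inverse (1 + z)) < 1" "inverse (1 + z) \<noteq> 0"
    proof -
      show "norm (inverse (1 + z)) < 1"
        unfolding w norm_of_real using x by simp
      show "inverse (1 + z) \<noteq> 0" using z(4) by simp
    qed
    have "1 - inverse (1 + z) = of_real (x / (1 + x))"
    proof -
      have "1 - inverse (1 + z) = z / (1 + z)"
        using z(4) by (simp add: divide_simps)
      thus ?thesis by (simp add: z_def)
    qed
    hence "ln (1 - inverse (1 + z)) = of_real (ln (x / (1 + x)))"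
      using x by (simp only: Ln_of_real divide_pos_pos add_pos_pos zero_less_one)
    also have "ln (x / (1 + x)) = ln x - ln (1 + x)"
      using x by (simp add: ln_div)
    finally have ln_w: "ln (1 - inverse (1 + z)) = ln z - U"
      using x by (simp add: U_def z_def Ln_of_real Ln_one_plus_of_real)
    have dl: "((\<lambda>z. ln z) has_field_derivative p) (at z)"
      unfolding z_def p_def by (rule Ln_deriv_of_real[OF x(1)])
    have dU: "((\<lambda>z. ln (1 + z)) has_field_derivative v) (at z)"
      unfolding z_def v_def by (rule Ln_one_plus_deriv_of_real) (use x in simp)
    have dU2: "((\<lambda>z. (ln (1 + z))\<^sup>2) has_field_derivative 2 * U * v) (at z)"
      using DERIV_power[OF dU, of 2] by (simp add: U_def mult_ac)
    have dU3: "((\<lambda>z. (ln (1 + z)) ^ 3) has_field_derivative 3 * U\<^sup>2 * v) (at z)"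
      using DERIV_power[OF dU, of 3] by (simp add: U_def mult_ac)
    have d1: "((\<lambda>z. polylog 2 (inverse (1 + z))) has_field_derivative - (ln z - U) * - v) (at z)"
      unfolding v_def ln_w[symmetric]
      by (rule polylog2_chain[OF log_deriv_inverse_one_plus[OF z(3)] nw])
    have d2: "((\<lambda>z. polylog 3 (inverse (1 + z))) has_field_derivative polylog 2 (inverse (1 + z)) * - v) (at z)"
      unfolding v_def by (rule polylog3_chain[OF log_deriv_inverse_one_plus[OF z(3)] nw])
    have dM: "((\<lambda>z. log_square_primitive (- z)) has_field_derivative - (ln (1 - - z))\<^sup>2 * inverse (- z) * - 1) (at z)"
      by (rule DERIV_chain2[where f = log_square_primitive and g = uminus, OF log_square_primitive_deriv[OF z(1,2)]])
         (auto intro!: derivative_eq_intros)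
    hence dM: "((\<lambda>z. log_square_primitive (- z)) has_field_derivative - U\<^sup>2 * p) (at z)"
      by (simp add: U_def p_def)
    show "(F has_field_derivative 0) (at z)"
      unfolding F_def
    proof (rule DERIV_cong)
      show "((\<lambda>z. log_square_primitive (- z) + (ln (1 + z))\<^sup>2 * ln z - 2 / 3 * ln (1 + z) ^ 3
      - 2 * (ln (1 + z) * polylog 2 (inverse (1 + z))) - 2 * polylog 3 (inverse (1 + z))) has_field_derivative
          (- U\<^sup>2 * p + (2 * U * v * ln z + p * (ln (1 + z))\<^sup>2) - 2 / 3 * (3 * U\<^sup>2 * v)
            - 2 * (v * polylog 2 (inverse (1 + z)) + - (ln z - U) * - v * ln (1 + z))
            - 2 * (polylog 2 (inverse (1 + z)) * - v))) (at z)"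
        by (intro DERIV_add DERIV_diff DERIV_cmult DERIV_mult dM d1 d2 dU3 dU2 dU dl)
    qed (simp add: U_def[symmetric] algebra_simps power2_eq_square)
  next
    have M: "((\<lambda>x. log_square_primitive (- complex_of_real x)) \<longlongrightarrow> 0) (at_right 0)"
      using tendsto_minus[OF tendsto_complex_of_real_right[of 0]]
      by (intro log_square_primitive_compose_tendsto_0 eventually_at_right_0I) auto
    have ln1: "((\<lambda>x. ln (1 + complex_of_real x)) \<longlongrightarrow> ln (1 + of_real 0)) (at_right 0)"
      by (intro tendsto_Ln tendsto_intros) auto
    have inv: "((\<lambda>x. inverse (1 + complex_of_real x)) \<longlongrightarrow> inverse (1 + of_real 0)) (at_right 0)"
      by (intro tendsto_intros) auto
    have ln2: "((\<lambda>x. (ln (1 + complex_of_real x))\<^sup>2 * ln (of_real x)) \<longlongrightarrow> of_real 0) (at_right 0)"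
    proof (rule tendsto_complex_of_real_transform[where r = "\<lambda>x. (ln (1 + x))\<^sup>2 * ln x"])
      show "((\<lambda>x::real. (ln (1 + x))\<^sup>2 * ln x) \<longlongrightarrow> 0) (at_right 0)" by real_asymp
      show "\<forall>\<^sub>F x in at_right 0. (ln (1 + complex_of_real x))\<^sup>2 * ln (of_real x) = of_real ((ln (1 + x))\<^sup>2 * ln x)"
        by (rule eventually_at_right_0I) (simp add: Ln_of_real Ln_one_plus_of_real)
    qed
    have "((\<lambda>x. F (of_real x)) \<longlongrightarrow> 0 + of_real 0 - 2 / 3 * ln (1 + of_real 0) ^ 3
            - 2 * (ln (1 + of_real 0) * polylog 2 (inverse (1 + of_real 0)))
            - 2 * polylog 3 (inverse (1 + of_real 0))) (at_right 0)"
      unfolding F_def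
      by (intro tendsto_add tendsto_diff M ln2 tendsto_mult tendsto_const ln1 inv tendsto_power
          polylog_tendsto eventually_at_right_0I)
         (auto intro: norm_inverse_one_plus_of_real_le_1)
    thus "((\<lambda>x. F (of_real x)) \<longlongrightarrow> - 2 * zeta 3) (at_right 0)"
      by (simp add: polylog3_1)
  next
    define L where "L = (\<lambda>x. ln (1 - complex_of_real x))"
    define P where "P = (\<lambda>x. ln (1 + complex_of_real x))"
    define A where "A = (\<lambda>x. polylog 2 ((1 + complex_of_real x) / 2))"
    define B where "B = (\<lambda>x. polylog 2 ((1 - complex_of_real x) / 2))"
    define T where "T = (\<lambda>x. polylog 3 ((1 + complex_of_real x) / 2))"
    have id: "((\<lambda>x. complex_of_real x) \<longlongrightarrow> 1) (at_left 1)"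
      using tendsto_complex_of_real_left[of 1] by simp
    have inv: "((\<lambda>x. inverse (1 + complex_of_real x)) \<longlongrightarrow> 1 / 2) (at_left 1)"
      using tendsto_inverse[OF tendsto_add[OF tendsto_const id], of 1] by (simp add: inverse_eq_divide)
    have G: "((\<lambda>x. G (- complex_of_real x)) \<longlongrightarrow> G (- 1)) (at_left 1)"
      by (rule continuous_on_tendsto_compose[OF G_continuous tendsto_minus[OF id]])
         (auto intro!: eventually_at_left_1I)
    have P: "(P \<longlongrightarrow> h) (at_left 1)"
      unfolding P_def h_def using tendsto_Ln[OF tendsto_add[OF tendsto_const id, of 1]]
      by (simp add: complex_nonpos_Reals_iff)
    have half: "((\<lambda>x. (1 + complex_of_real x) / 2) \<longlongrightarrow> 1) (at_left 1)"
      using tendsto_divide[OF tendsto_add[OF tendsto_const id, of 1] tendsto_const, of 2] by simp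
    have half_le: "\<forall>\<^sub>F x in at_left 1. norm ((1 + complex_of_real x) / 2) \<le> 1"
      using half_1_plus_mem by (intro eventually_at_left_1I) auto
    have A: "(A \<longlongrightarrow> c) (at_left 1)"
      using polylog_tendsto[OF _ half _ half_le, of 2] by (simp add: A_def polylog2_1 c_def)
    have T: "(T \<longlongrightarrow> zeta 3) (at_left 1)"
      using polylog_tendsto[OF _ half _ half_le, of 3] by (simp add: T_def polylog3_1)
    have B: "(B \<longlongrightarrow> 0) (at_left 1)"
    proof -
      have "(B \<longlongrightarrow> polylog 2 ((1 - 1) / 2)) (at_left 1)"
        unfolding B_def
        by (intro polylog_tendsto tendsto_divide tendsto_diff tendsto_const id eventually_at_left_1I)
           (auto simp: norm_divide norm_one_minus_of_real)
      thus ?thesis by simp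
    qed
    have Li: "((\<lambda>x. polylog 2 (- complex_of_real x)) \<longlongrightarrow> polylog 2 (- 1)) (at_left 1)"
      by (intro polylog_tendsto tendsto_minus id eventually_at_left_1I) auto
    have W: "((\<lambda>x. polylog m (inverse (1 + complex_of_real x))) \<longlongrightarrow> polylog m (1 / 2)) (at_left 1)"
      if "m \<ge> 2" for m
      by (intro polylog_tendsto inv that eventually_at_left_1I norm_inverse_one_plus_of_real_le_1) auto
    have LP: "((\<lambda>x. L x * ((P x)\<^sup>2 - h\<^sup>2)) \<longlongrightarrow> of_real 0) (at_left 1)"
    proof (rule tendsto_complex_of_real_transform[where r = "\<lambda>x. ln (1 - x) * ((ln (1 + x))\<^sup>2 - (ln 2)\<^sup>2)"])
      show "((\<lambda>x::real. ln (1 - x) * ((ln (1 + x))\<^sup>2 - (ln 2)\<^sup>2)) \<longlongrightarrow> 0) (at_left 1)" by real_asymp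
      show "\<forall>\<^sub>F x in at_left 1. L x * ((P x)\<^sup>2 - h\<^sup>2) = of_real (ln (1 - x) * ((ln (1 + x))\<^sup>2 - (ln 2)\<^sup>2))"
        by (rule eventually_at_left_1I)
           (simp add: P_def L_def h_def Ln_one_plus_of_real Ln_one_minus_of_real complex_ln_2)
    qed
    have Pl: "((\<lambda>x. (P x)\<^sup>2 * ln (of_real x)) \<longlongrightarrow> of_real 0) (at_left 1)"
    proof (rule tendsto_complex_of_real_transform[where r = "\<lambda>x. (ln (1 + x))\<^sup>2 * ln x"])
      show "((\<lambda>x::real. (ln (1 + x))\<^sup>2 * ln x) \<longlongrightarrow> 0) (at_left 1)" by real_asymp
      show "\<forall>\<^sub>F x in at_left 1. (P x)\<^sup>2 * ln (of_real x) = of_real ((ln (1 + x))\<^sup>2 * ln x)"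
        by (rule eventually_at_left_1I) (simp add: P_def Ln_of_real Ln_one_plus_of_real)
    qed
    \<comment> \<open>Here \<open>L\<close> is the only unbounded term, and its factor \<open>P\<^sup>2 - h\<^sup>2\<close> vanishes at \<open>1\<close>.\<close>
    have F_eq: "F (of_real x) = G (- of_real x) - (P x * (2 * B x - c) + 2 * (L x * ((P x)\<^sup>2 - h\<^sup>2))
          + 2 * h * (B x - polylog 2 (1 / 2)) - 2 * h * (P x)\<^sup>2 + 4 * P x * A x
          - 4 * (T x - polylog 3 (1 / 2))) + P x * polylog 2 (- of_real x)
        + (P x)\<^sup>2 * ln (of_real x) - 2 / 3 * P x ^ 3
        - 2 * (P x * polylog 2 (inverse (1 + of_real x))) - 2 * polylog 3 (inverse (1 + of_real x))" for x
      unfolding F_def log_square_primitive_def G_explicit_def P_def L_def A_def B_def T_def c_def h_def by simp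
    have "((\<lambda>x. F (of_real x)) \<longlongrightarrow> G (- 1) - (h * (2 * 0 - c) + 2 * of_real 0
          + 2 * h * (0 - polylog 2 (1 / 2)) - 2 * h * h\<^sup>2 + 4 * h * c
          - 4 * (zeta 3 - polylog 3 (1 / 2))) + h * polylog 2 (- 1)
        + of_real 0 - 2 / 3 * h ^ 3
        - 2 * (h * polylog 2 (1 / 2)) - 2 * polylog 3 (1 / 2)) (at_left 1)"
      unfolding F_eq
      by (intro tendsto_add tendsto_diff LP Pl tendsto_mult tendsto_power tendsto_const G P A B T Li W) auto
    thus "((\<lambda>x. F (of_real x)) \<longlongrightarrow> G (-1) - (- h * c - 2 * h * polylog 2 (1 / 2) - 2 * h ^ 3 + 4 * h * c
      - 4 * (zeta 3 - polylog 3 (1 / 2))) + h * polylog 2 (-1)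
      - 2 / 3 * h ^ 3 - 2 * (h * polylog 2 (1 / 2)) - 2 * polylog 3 (1 / 2)) (at_left 1)"
      by (simp add: power3_eq_cube power2_eq_square)
  qed simp
  hence "G (-1) = - 2 * zeta 3 + (- h * c - 2 * h * polylog 2 (1 / 2) - 2 * h ^ 3 + 4 * h * c
      - 4 * zeta 3 + 2 * (2 * polylog 3 (1 / 2))) - h * polylog 2 (-1)
      + 2 / 3 * h ^ 3 + 2 * (h * polylog 2 (1 / 2)) + 2 * polylog 3 (1 / 2)"
    by (simp add: algebra_simps)
  moreover have "polylog 2 (-1) = - (of_real pi ^ 2 / 12)"
    using polylog_minus_1[of 2] by (simp add: polylog2_1)
  ultimately show ?thesis
    unfolding polylog3_half polylog2_half h_def c_def
    by (simp add: algebra_simps power3_eq_cube power2_eq_square)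
qed

theorem corollary12:
  shows "(\<forall>z::complex. norm z \<le> 1 \<longrightarrow> set_integrable lborel unit_square (g_integrand z))
    \<and> (\<forall>z::complex. norm z \<le> 1 \<and> z \<noteq> 1 \<longrightarrow> g z = g_closed z)
    \<and> (g_closed \<longlongrightarrow> g 1) (at 1 within cball 0 1)
    \<and> g 1 = ln 2
    \<and> g (-1) = of_real pi ^ 2 / 24
    \<and> (\<forall>z::complex. norm z \<le> 1 \<longrightarrow> set_integrable lborel unit_square (G_integrand z))
    \<and> (\<forall>z::complex. norm z \<le> 1 \<and> z \<noteq> 1 \<and> z \<noteq> -1 \<longrightarrow> G z = G_closed z)
    \<and> (G_closed \<longlongrightarrow> G 1) (at 1 within cball 0 1)
    \<and> (G_closed \<longlongrightarrow> G (-1)) (at (-1) within cball 0 1)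
    \<and> G 1 = 3 / 2 * zeta 3 - of_real pi ^ 2 / 6 * ln 2 - 1 / 3 * (ln 2) ^ 3
    \<and> G (-1) = of_real pi ^ 2 / 12 * ln 2 - 3 / 4 * zeta 3 - 1 / 3 * (ln 2) ^ 3"
proof (intro conjI allI impI)
  fix z :: complex
  show "set_integrable lborel unit_square (g_integrand z)" if "norm z \<le> 1"
    by (rule g_power_series(1)[OF that])
  show "set_integrable lborel unit_square (G_integrand z)" if "norm z \<le> 1"
    by (rule G_power_series(1)[OF that])
  show "g z = g_closed z" if "norm z \<le> 1 \<and> z \<noteq> 1"
    using that by (blast intro: g_eq_g_closed)
  show "G z = G_closed z" if "norm z \<le> 1 \<and> z \<noteq> 1 \<and> z \<noteq> -1"
    using that by (blast intro: G_eq_G_closed)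
qed (rule g_closed_tendsto_1 g_1 g_minus_1 G_1 G_minus_1 G_closed_tendsto disjI1 disjI2 refl)+

end
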